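(* Let $N>K\ge2$, let $f$ satisfy (F1)–(F4), and let $V\in L^\infty(\mathbb{R}^N)$ and $(V_n)\subset L^\infty(\mathbb{R}^N)$ satisfy the inequalities in (V1). If $V_n\to V$ in $L^\infty(\mathbb{R}^N)$, then $c(V_n)\to c(V)$.
   Context: Points of $\mathbb{R}^N$ are written $x=(y,z)\in\mathbb{R}^K\times\mathbb{R}^{N-K}$, $N>K\ge2$, $2^*=\frac{2N}{N-2}$. $\mathcal G(K)=\mathcal O(K)\times I_{N-K}$; $u$ is $\mathcal G(K)$-invariant if $u(Ay,z)=u(y,z)$ for all $A\in\mathcal O(K)$. Assumptions on $f$, $F(u)=\int_0^uf$: (F1) $f$ continuous, $|f(u)|\le C(1+|u|^{p-1})$ for some $p\in(2,2^* )$; (F2) $f(u)=o(u)$ as $u\to0$; (F3) $F(u)/u^2\to\infty$ as $|u|\to\infty$; (F4) $f(u)/|u|$ increasing on $(-\infty,0)$ and on $(0,\infty)$. (V1) for a potential $W$: $0<\inf W\le W(0)<W_\infty\le\liminf_{|x|\to\infty}W(x)$ for some real $W_\infty$. $Y=\{u\in H^1(\mathbb{R}^N):\int\frac{u^2}{|y|^2}<\infty\}$, $Y^{\mathcal G(K)}$ its subspace of $\mathcal G(K)$-invariant functions. For a bounded potential $W$ with $\inf W>0$: $\mathcal J^W(u)=\frac12\int|\nabla u|^2+\frac{u^2}{|y|^2}+Wu^2\,dx-\int F(u)\,dx$ on $Y$, $\mathcal N^W=\{u\in Y^{\mathcal G(K)}\setminus\{0\}:\int|\nabla u|^2+\frac{u^2}{|y|^2}+Wu^2=\int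 f(u)u\}$, and $c(W)=\inf_{\mathcal N^W}\mathcal J^W$. *)

theory Defs
  imports "HOL-Analysis.Analysis"
begin

text \<open>Points of R^N are pairs x = (y,z) with y in R^K (type real^'k) and
  z in R^(N-K) (type real^'m); N = CARD('k) + CARD('m).\<close>

definition test_fun :: "('a::euclidean_space \<Rightarrow> real) \<Rightarrow> ('a \<Rightarrow> 'a \<Rightarrow> real) \<Rightarrow> bool" where
  "test_fun \<phi> \<phi>' \<longleftrightarrow> (\<forall>x. (\<phi> has_derivative \<phi>' x) (at x))
      \<and> (\<forall>i\<in>Basis. continuous_on UNIV (\<lambda>x. \<phi>' x i))
      \<and> bounded {x. \<phi> x \<noteq> 0}"

definition weak_gradient :: "('a::euclidean_space \<Rightarrow> real) \<Rightarrow> ('a \<Rightarrow> 'a) \<Rightarrow> bool" where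
  "weak_gradient u g \<longleftrightarrow> (\<forall>\<phi> \<phi>'. test_fun \<phi> \<phi>' \<longrightarrow>
      (\<forall>i\<in>Basis. (\<integral>x. u x * \<phi>' x i \<partial>lborel) = - (\<integral>x. (g x \<bullet> i) * \<phi> x \<partial>lborel)))"

definition in_H1 :: "('a::euclidean_space \<Rightarrow> real) \<Rightarrow> bool" where
  "in_H1 u \<longleftrightarrow> u \<in> borel_measurable lborel \<and> integrable lborel (\<lambda>x. (u x)\<^sup>2)
     \<and> (\<exists>g. g \<in> borel_measurable lborel \<and> integrable lborel (\<lambda>x. (norm (g x))\<^sup>2)
            \<and> weak_gradient u g)"

text \<open>The weak gradient (unique up to null sets).\<close>
definition grad :: "('a::euclidean_space \<Rightarrow> real) \<Rightarrow> ('a \<Rightarrow> 'a)" where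
  "grad u = (SOME g. g \<in> borel_measurable lborel \<and> integrable lborel (\<lambda>x. (norm (g x))\<^sup>2)
            \<and> weak_gradient u g)"

definition in_Y :: "((real^'k) \<times> (real^'m) \<Rightarrow> real) \<Rightarrow> bool" where
  "in_Y u \<longleftrightarrow> in_H1 u \<and> integrable lborel (\<lambda>x. (u x)\<^sup>2 / (norm (fst x))\<^sup>2)"

definition G_invariant :: "((real^'k) \<times> (real^'m) \<Rightarrow> real) \<Rightarrow> bool" where
  "G_invariant u \<longleftrightarrow> (\<forall>A::real^'k^'k. orthogonal_matrix A \<longrightarrow> (\<forall>y z. u (A *v y, z) = u (y, z)))"

definition YG :: "((real^'k) \<times> (real^'m) \<Rightarrow> real) set" where
  "YG = {u. in_Y u \<and> G_invariant u}"

definition Prim :: "(real \<Rightarrow> real) \<Rightarrow> real \<Rightarrow> real" where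
  "Prim f t = interval_lebesgue_integral lborel (ereal 0) (ereal t) f"

definition Qform :: "((real^'k) \<times> (real^'m) \<Rightarrow> real) \<Rightarrow> ((real^'k) \<times> (real^'m) \<Rightarrow> real) \<Rightarrow> real" where
  "Qform W u = (\<integral>x. (norm (grad u x))\<^sup>2 + (u x)\<^sup>2 / (norm (fst x))\<^sup>2 + W x * (u x)\<^sup>2 \<partial>lborel)"

definition JW :: "(real \<Rightarrow> real) \<Rightarrow> ((real^'k) \<times> (real^'m) \<Rightarrow> real) \<Rightarrow> ((real^'k) \<times> (real^'m) \<Rightarrow> real) \<Rightarrow> real" where
  "JW f W u = Qform W u / 2 - (\<integral>x. Prim f (u x) \<partial>lborel)"

definition nehari :: "(real \<Rightarrow> real) \<Rightarrow> ((real^'k) \<times> (real^'m) \<Rightarrow> real) \<Rightarrow> ((real^'k) \<times> (real^'m) \<Rightarrow> real) set" where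
  "nehari f W = {u \<in> YG. \<not> (AE x in lborel. u x = 0)
       \<and> Qform W u = (\<integral>x. f (u x) * u x \<partial>lborel)}"

definition cW :: "(real \<Rightarrow> real) \<Rightarrow> ((real^'k) \<times> (real^'m) \<Rightarrow> real) \<Rightarrow> real" where
  "cW f W = Inf (JW f W ` nehari f W)"

definition V1 :: "('a::real_normed_vector \<Rightarrow> real) \<Rightarrow> bool" where
  "V1 W \<longleftrightarrow> 0 < Inf (range W) \<and> Inf (range W) \<le> W 0
     \<and> (\<exists>Winf::real. W 0 < Winf \<and> ereal Winf \<le> Liminf at_infinity (\<lambda>x. ereal (W x)))"

definition Linf_pot :: "('a::euclidean_space \<Rightarrow> real) \<Rightarrow> bool" where
  "Linf_pot W \<longleftrightarrow> W \<in> borel_measurable lborel \<and> bounded (range W)"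

end

theory Submission
  imports Defs
begin

text \<open>Along each ray \<open>t \<mapsto> tu\<close> the energy is maximal on the Nehari manifold, since \<open>f(s)/s\<close> is
  monotone in \<open>\<bar>s\<bar>\<close>. So if \<open>u\<close> is almost minimal for \<open>W\<close> and \<open>tu\<close> is the Nehari function for \<open>W'\<close> on
  the same ray, then \<open>c(W')\<close> exceeds \<open>c(W)\<close> by at most \<open>\<parallel>W' - W\<parallel> \<parallel>tu\<parallel>\<^sup>2 / 2\<close> up to an arbitrarily small
  error, and it suffices to bound \<open>\<parallel>tu\<parallel>\<close> in \<open>L\<^sup>2\<close> uniformly. For this, the normalised function has mass
  bounded below on some \<open>{\<bar>v\<bar> \<ge> \<eta>}\<close>, which follows from the energy bound and the subcritical Sobolev
  embedding by splitting \<open>F\<close> into small, intermediate and large values; no concentration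
  compactness is needed.

  The Sobolev embedding is obtained by bootstrapping: comparing \<open>u\<close> with its averages over balls
  of a radius depending on \<open>l\<close> shows that a bound in \<open>L\<^sup>q\<close> gives
  \<open>\<integral>\<^bsub>{\<bar>u\<bar> > l}\<^esub> u\<^sup>2 = O(l\<^bsup>-2q/N\<^esup>)\<close>, hence a bound in \<open>L\<^sup>s\<close> for every \<open>s < 2 + 2q/N\<close>.\<close>

section \<open>Averages and translations in \<open>L\<^sup>2\<close>\<close>

text \<open>The obstacle is that superlinearity is assumed only in the form F3, without an
  Ambrosetti-Rabinowitz inequality: on the Nehari set a bound on the energy does not bound the norm
  by algebra. Therefore \<open>u\<close> is rescaled to \<open>v\<close> with
  \<open>Qform W v = 1\<close>, and what is bounded is the parameter \<open>t\<close> that puts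
  \<open>t * v\<close> on the Nehari set of \<open>W'\<close>. It satisfies
  \<open>fiber v t = Qform W' v \<le> 2\<close>, so it is enough that \<open>fiber v\<close> passes
  2 at a point depending only on the energy bound and on a lower bound of the potentials. Mass of
  \<open>v\<close> on a superlevel set forces this wherever in space the mass lies. As nothing else
  about the potentials enters, the comparison runs from V to V_n and from V_n to V with the same
  constant.

  The Sobolev bound is used at some \<open>q\<close> strictly between \<open>p\<close> and the
  critical exponent: a small multiple of \<open>|s| powr q\<close> then absorbs
  \<open>|s| powr p\<close> for large values.

  Weak gradients are only tested against C1 functions, so estimates are proved for mollifications
  first. The factor 2 lost on passing to the limit is harmless, since later steps need only some
  constant.\<close>

lemma nn_integral_lborel_translate:
  fixes f :: "'a::euclidean_space \<Rightarrow> ennreal"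
  assumes [measurable]: "f \<in> borel_measurable borel"
  shows "(\<integral>\<^sup>+x. f (x + h) \<partial>lborel) = (\<integral>\<^sup>+x. f x \<partial>lborel)"
proof -
  have "(\<integral>\<^sup>+x. f x \<partial>lborel) = (\<integral>\<^sup>+x. f x \<partial>distr lborel borel ((+) h))"
    by (simp add: lborel_distr_plus)
  also have "\<dots> = (\<integral>\<^sup>+x. f (h + x) \<partial>lborel)"
    by (subst nn_integral_distr) auto
  finally show ?thesis by (simp add: add.commute)
qed

lemma integral_lborel_translate:
  fixes f :: "'a::euclidean_space \<Rightarrow> real"
  assumes [measurable]: "f \<in> borel_measurable borel"
  shows "(\<integral>x. f (x + h) \<partial>lborel) = (\<integral>x. f x \<partial>lborel)"
proof -
  have "(\<integral>x. f x \<partial>lborel) = (\<integral>x. f x \<partial>distr lborel borel ((+) h))"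
    by (simp add: lborel_distr_plus)
  also have "\<dots> = (\<integral>x. f (h + x) \<partial>lborel)"
    by (subst integral_distr) auto
  finally show ?thesis by (simp add: add.commute)
qed

lemma integrable_lborel_translate:
  fixes f :: "'a::euclidean_space \<Rightarrow> real"
  assumes "integrable lborel f"
  shows "integrable lborel (\<lambda>x. f (x + h))"
proof -
  have [measurable]: "f \<in> borel_measurable borel"
    using assms by auto
  have "integrable (distr lborel borel ((+) h)) f"
    using assms by (simp add: lborel_distr_plus)
  then show ?thesis
    by (subst (asm) integrable_distr_eq) (auto simp: add.commute)
qed

lemma integrable_mult_L2:
  fixes f g :: "'a \<Rightarrow> real"
  assumes [measurable]: "f \<in> borel_measurable M" "g \<in> borel_measurable M"
    and "integrable M (\<lambda>x. (f x)\<^sup>2)" "integrable M (\<lambda>x. (g x)\<^sup>2)"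
  shows "integrable M (\<lambda>x. f x * g x)"
proof (rule Bochner_Integration.integrable_bound)
  show "integrable M (\<lambda>x. (f x)\<^sup>2 + (g x)\<^sup>2)"
    using assms by auto
  have "\<bar>a * b\<bar> \<le> a\<^sup>2 + b\<^sup>2" for a b :: real
  proof -
    have "0 \<le> (\<bar>a\<bar> - \<bar>b\<bar>)\<^sup>2 + \<bar>a\<bar> * \<bar>b\<bar>" by auto
    then have "\<bar>a\<bar> * \<bar>b\<bar> \<le> a\<^sup>2 + b\<^sup>2" by (simp add: power2_diff)
    then show ?thesis by (simp add: abs_mult)
  qed
  then show "AE x in M. norm (f x * g x) \<le> norm ((f x)\<^sup>2 + (g x)\<^sup>2)"
    by auto
qed auto

lemma continuous_bounded_support_integrable:
  fixes f :: "'a::euclidean_space \<Rightarrow> real"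
  assumes "continuous_on UNIV f" "bounded {x. f x \<noteq> 0}"
  shows "integrable lborel f"
proof -
  obtain a where a: "{x. f x \<noteq> 0} \<subseteq> cbox (-a) a"
    using bounded_subset_cbox_symmetric[OF assms(2)] by auto
  have "integrable lborel (\<lambda>x. indicator (cbox (-a) a) x *\<^sub>R f x)"
    by (rule borel_integrable_compact) (auto intro: continuous_on_subset[OF assms(1)])
  also have "(\<lambda>x. indicator (cbox (-a) a) x *\<^sub>R f x) = f"
  proof
    fix x
    show "indicator (cbox (-a) a) x *\<^sub>R f x = f x"
      using a by (cases "f x = 0") (auto simp del: mem_box)
  qed
  finally show ?thesis .
qed

text \<open>Jensen's inequality for the density \<open>K\<close>, from nonnegativity of the
  variance. With values in \<open>ennreal\<close> no integrability of \<open>g\<close> is required: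
  the right side is infinite, or its finiteness makes \<open>K x * g x\<close> integrable.\<close>

lemma weighted_mean_square_le:
  fixes K g :: "'a \<Rightarrow> real"
  assumes K: "integrable M K" "\<And>x. 0 \<le> K x" "(\<integral>x. K x \<partial>M) = 1"
    and [measurable]: "g \<in> borel_measurable M"
  shows "ennreal ((\<integral>x. K x * g x \<partial>M)\<^sup>2) \<le> (\<integral>\<^sup>+x. ennreal (K x * (g x)\<^sup>2) \<partial>M)"
proof (cases "(\<integral>\<^sup>+x. ennreal (K x * (g x)\<^sup>2) \<partial>M) = \<infinity>")
  case False
  have [measurable]: "K \<in> borel_measurable M" using K by auto
  have int2: "integrable M (\<lambda>x. K x * (g x)\<^sup>2)"
    using False K by (intro integrableI_nonneg) (auto simp: less_top)
  have int1: "integrable M (\<lambda>x. K x * g x)"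
  proof (rule Bochner_Integration.integrable_bound)
    show "integrable M (\<lambda>x. K x + K x * (g x)\<^sup>2)"
      using K int2 by auto
    have "\<bar>a\<bar> \<le> 1 + a\<^sup>2" for a :: real
    proof -
      have "0 \<le> (\<bar>a\<bar> - 1)\<^sup>2" "0 \<le> \<bar>a\<bar>" by auto
      then show ?thesis by (simp add: power2_diff)
    qed
    then have "\<bar>K x\<bar> * \<bar>g x\<bar> \<le> K x * (1 + (g x)\<^sup>2)" for x
      using K(2)[of x] by (intro mult_mono) auto
    then show "AE x in M. norm (K x * g x) \<le> norm (K x + K x * (g x)\<^sup>2)"
      using K(2) by (auto simp: abs_mult algebra_simps)
  qed auto
  define m where "m = (\<integral>x. K x * g x \<partial>M)"
  have "0 \<le> (\<integral>x. K x * (g x - m)\<^sup>2 \<partial>M)"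
    using K by (intro integral_nonneg_AE) auto
  also have "(\<integral>x. K x * (g x - m)\<^sup>2 \<partial>M) = (\<integral>x. K x * (g x)\<^sup>2 - 2 * m * (K x * g x) + m\<^sup>2 * K x \<partial>M)"
    by (intro Bochner_Integration.integral_cong) (auto simp: power2_eq_square algebra_simps)
  also have "\<dots> = (\<integral>x. K x * (g x)\<^sup>2 \<partial>M) - 2 * m * m + m\<^sup>2"
    using int1 int2 K by (simp add: m_def)
  finally have "m\<^sup>2 \<le> (\<integral>x. K x * (g x)\<^sup>2 \<partial>M)"
    by (simp add: power2_eq_square)
  then have "ennreal (m\<^sup>2) \<le> ennreal (\<integral>x. K x * (g x)\<^sup>2 \<partial>M)"
    by (intro ennreal_leI)
  also have "\<dots> = (\<integral>\<^sup>+x. ennreal (K x * (g x)\<^sup>2) \<partial>M)"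
    using int2 K by (intro nn_integral_eq_integral[symmetric]) auto
  finally show ?thesis by (simp add: m_def)
qed auto

text \<open>Jensen pointwise in \<open>x\<close>, then Fubini: an average of functions inherits
  their common L2 bound. The family will consist of translates or of translation differences of one
  function.\<close>

lemma nn_integral_weighted_mean_square_le:
  fixes K :: "'b::euclidean_space \<Rightarrow> real" and \<Phi> :: "'a::euclidean_space \<Rightarrow> 'b \<Rightarrow> real"
  assumes K: "integrable lborel K" "\<And>h. 0 \<le> K h" "(\<integral>h. K h \<partial>lborel) = 1"
    and [measurable]: "(\<lambda>(x, h). \<Phi> x h) \<in> borel_measurable (borel \<Otimes>\<^sub>M borel)"
    and le: "\<And>h. K h \<noteq> 0 \<Longrightarrow> (\<integral>\<^sup>+x. ennreal ((\<Phi> x h)\<^sup>2) \<partial>lborel) \<le> c"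
  shows "(\<integral>\<^sup>+x. ennreal ((\<integral>h. K h * \<Phi> x h \<partial>lborel)\<^sup>2) \<partial>lborel) \<le> c"
proof -
  have [measurable]: "K \<in> borel_measurable borel" using K by auto
  have "(\<integral>\<^sup>+x. ennreal ((\<integral>h. K h * \<Phi> x h \<partial>lborel)\<^sup>2) \<partial>lborel)
      \<le> (\<integral>\<^sup>+x. (\<integral>\<^sup>+h. ennreal (K h * (\<Phi> x h)\<^sup>2) \<partial>lborel) \<partial>lborel)"
    by (intro nn_integral_mono weighted_mean_square_le K) auto
  also have "\<dots> = (\<integral>\<^sup>+h. (\<integral>\<^sup>+x. ennreal (K h * (\<Phi> x h)\<^sup>2) \<partial>lborel) \<partial>lborel)"
    by (intro lborel_pair.Fubini'[symmetric]) measurable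
  also have "\<dots> = (\<integral>\<^sup>+h. ennreal (K h) * (\<integral>\<^sup>+x. ennreal ((\<Phi> x h)\<^sup>2) \<partial>lborel) \<partial>lborel)"
    using K(2) by (simp add: ennreal_mult nn_integral_cmult)
  also have "\<dots> \<le> (\<integral>\<^sup>+h. ennreal (K h) * c \<partial>lborel)"
  proof (rule nn_integral_mono)
    fix h
    show "ennreal (K h) * (\<integral>\<^sup>+x. ennreal ((\<Phi> x h)\<^sup>2) \<partial>lborel) \<le> ennreal (K h) * c"
      using le[of h] by (cases "K h = 0") (auto intro: mult_left_mono)
  qed
  also have "\<dots> = (\<integral>\<^sup>+h. ennreal (K h) \<partial>lborel) * c"
    by (rule nn_integral_multc) auto
  also have "(\<integral>\<^sup>+h. ennreal (K h) \<partial>lborel) = 1"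
    using K by (subst nn_integral_eq_integral) auto
  finally show ?thesis by simp
qed

lemma nn_integral_square_add_le:
  fixes f g :: "'a \<Rightarrow> real"
  assumes [measurable]: "f \<in> borel_measurable M" "g \<in> borel_measurable M"
  shows "(\<integral>\<^sup>+x. ennreal ((f x + g x)\<^sup>2) \<partial>M)
    \<le> 2 * (\<integral>\<^sup>+x. ennreal ((f x)\<^sup>2) \<partial>M) + 2 * (\<integral>\<^sup>+x. ennreal ((g x)\<^sup>2) \<partial>M)"
proof -
  have "(a + b)\<^sup>2 \<le> 2 * a\<^sup>2 + 2 * b\<^sup>2" for a b :: real
    using zero_le_power2[of "a - b"] by (simp add: power2_eq_square algebra_simps)
  then have "(\<integral>\<^sup>+x. ennreal ((f x + g x)\<^sup>2) \<partial>M) \<le> (\<integral>\<^sup>+x. ennreal (2 * (f x)\<^sup>2 + 2 * (g x)\<^sup>2) \<partial>M)"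
    by (intro nn_integral_mono ennreal_leI)
  also have "\<dots> = (\<integral>\<^sup>+x. 2 * ennreal ((f x)\<^sup>2) + 2 * ennreal ((g x)\<^sup>2) \<partial>M)"
    by (intro nn_integral_cong) (simp add: ennreal_plus ennreal_mult)
  also have "\<dots> = 2 * (\<integral>\<^sup>+x. ennreal ((f x)\<^sup>2) \<partial>M) + 2 * (\<integral>\<^sup>+x. ennreal ((g x)\<^sup>2) \<partial>M)"
    by (simp add: nn_integral_add nn_integral_cmult)
  finally show ?thesis .
qed

section \<open>Density of continuous functions and continuity of translations in L2\<close>

lemma continuous_dense_L2:
  fixes v :: "'a::euclidean_space \<Rightarrow> real"
  assumes [measurable]: "v \<in> borel_measurable borel" and v2: "integrable lborel (\<lambda>x. (v x)\<^sup>2)" and "0 < e"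
  obtains w where "continuous_on UNIV w" "bounded {x. w x \<noteq> 0}"
    "(\<integral>\<^sup>+x. ennreal ((v x - w x)\<^sup>2) \<partial>lborel) \<le> ennreal e"
proof -
  \<comment> \<open>\<open>\<kappa> R\<close> cuts off in space and \<open>cl R\<close> clips
    values. The same \<open>R\<close> serves for both, so at each point \<open>vR R\<close> equals
    \<open>v\<close> once \<open>R\<close> is large.\<close>
  define \<kappa> where "\<kappa> R x = max 0 (min 1 (R + 1 - norm x))" for R and x :: 'a
  define cl where "cl R t = max (-R) (min R t)" for R t :: real
  have \<kappa>01: "0 \<le> \<kappa> R x" "\<kappa> R x \<le> 1" for R x by (auto simp: \<kappa>_def)
  have \<kappa>c: "continuous_on UNIV (\<kappa> R)" for R unfolding \<kappa>_def by (intro continuous_intros)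
  have [measurable]: "\<kappa> R \<in> borel_measurable borel" for R
    using \<kappa>c by (rule borel_measurable_continuous_onI)
  have clc: "continuous_on UNIV (cl R)" for R unfolding cl_def by (intro continuous_intros)
  have [measurable]: "cl R \<in> borel_measurable borel" for R
    using clc by (rule borel_measurable_continuous_onI)
  have cl_bound: "\<bar>cl R t\<bar> \<le> R" if "0 \<le> R" for R t using that by (auto simp: cl_def)
  have cl_le: "\<bar>cl R t\<bar> \<le> \<bar>t\<bar>" if "0 \<le> R" for R t using that by (auto simp: cl_def)
  define vR where "vR R x = cl R (v x) * \<kappa> R x" for R x
  have [measurable]: "vR R \<in> borel_measurable borel" for R unfolding vR_def by measurable
  have vR_le: "\<bar>vR R x\<bar> \<le> \<bar>v x\<bar>" if "0 \<le> R" for R x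
  proof -
    have "\<bar>cl R (v x)\<bar> * \<bar>\<kappa> R x\<bar> \<le> \<bar>v x\<bar> * 1"
      using cl_le[OF that, of "v x"] \<kappa>01[of R x] by (intro mult_mono) auto
    then show ?thesis by (simp add: vR_def abs_mult)
  qed
  have "(\<lambda>n. \<integral>x. (v x - vR (real n) x)\<^sup>2 \<partial>lborel) \<longlonglongrightarrow> (\<integral>x. 0 \<partial>(lborel::'a measure))"
  proof (rule integral_dominated_convergence)
    show "integrable lborel (\<lambda>x. 4 * (v x)\<^sup>2)" using v2 by auto
    show "AE x in lborel. (\<lambda>n. (v x - vR (real n) x)\<^sup>2) \<longlonglongrightarrow> 0"
    proof (rule AE_I2)
      fix x
      obtain m :: nat where m: "norm x + \<bar>v x\<bar> \<le> real m" using real_arch_simple by blast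
      have "(v x - vR (real n) x)\<^sup>2 = 0" if "n \<ge> m" for n
      proof -
        have "real m \<le> real n" using that by simp
        then have n: "norm x \<le> real n" "\<bar>v x\<bar> \<le> real n"
          using m norm_ge_zero[of x] abs_ge_zero[of "v x"] by linarith+
        then show ?thesis by (auto simp: vR_def cl_def \<kappa>_def min_def max_def)
      qed
      then show "(\<lambda>n. (v x - vR (real n) x)\<^sup>2) \<longlonglongrightarrow> 0"
        by (intro tendsto_eventually) (auto simp: eventually_sequentially)
    qed
    fix n
    have "(v x - vR (real n) x)\<^sup>2 \<le> (2 * v x)\<^sup>2" for x
      using vR_le[of "real n" x] by (subst abs_le_square_iff[symmetric]) auto
    then show "AE x in lborel. norm ((v x - vR (real n) x)\<^sup>2) \<le> 4 * (v x)\<^sup>2"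
      by (auto simp: power2_eq_square)
  qed auto
  then have "\<forall>\<^sub>F n in sequentially. (\<integral>x. (v x - vR (real n) x)\<^sup>2 \<partial>lborel) < e / 4"
    using \<open>0 < e\<close> by (intro order_tendstoD(2)) auto
  then obtain n where n: "(\<integral>x. (v x - vR (real n) x)\<^sup>2 \<partial>lborel) < e / 4"
    by (auto simp: eventually_sequentially)
  define R where "R = real n"
  have R0: "0 \<le> R" by (simp add: R_def)
  \<comment> \<open>Measurability yields continuous functions converging to \<open>v\<close> almost
    everywhere, but without any bound. Clipping and cutting them off as was done with
    \<open>v\<close> makes dominated convergence applicable on a fixed ball.\<close>
  have "v \<in> borel_measurable lebesgue"
    by (auto intro: measurable_completion)
  then have "v measurable_on UNIV"
    using lebesgue_measurable_imp_measurable_on[of v UNIV] by simp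
  then obtain N g where N: "negligible N" and gc: "\<And>n. continuous_on UNIV (g n)"
    and glim: "\<And>x. x \<notin> N \<Longrightarrow> (\<lambda>n. g n x) \<longlonglongrightarrow> v x"
    unfolding measurable_on_def by auto
  define w where "w j x = cl R (g j x) * \<kappa> R x" for j :: nat and x
  have wc: "continuous_on UNIV (w j)" for j
    unfolding w_def
    by (intro continuous_intros \<kappa>c continuous_on_compose2[OF clc gc]) auto
  have [measurable]: "w j \<in> borel_measurable borel" for j
    using wc by (rule borel_measurable_continuous_onI)
  have wz: "w j x = 0" "vR R x = 0" if "x \<notin> cball 0 (R + 1)" for j x
    using that by (auto simp: w_def vR_def \<kappa>_def)
  have "(\<lambda>j. \<integral>x. (vR R x - w j x)\<^sup>2 \<partial>lborel) \<longlonglongrightarrow> (\<integral>x. 0 \<partial>(lborel::'a measure))"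
  proof (rule integral_dominated_convergence)
    show "integrable lborel (\<lambda>x::'a. (2 * R)\<^sup>2 * indicator (cball 0 (R + 1)) x)"
      by (intro integrable_mult_right integrable_real_indicator)
         (use emeasure_lborel_cball_finite[of "0::'a" "R + 1"] in \<open>auto simp: less_top[symmetric]\<close>)
    have "AE x in lebesgue. x \<notin> N"
      using N by (simp add: negligible_iff_null_sets AE_not_in)
    then have "AE x in lebesgue. (\<lambda>j. (vR R x - w j x)\<^sup>2) \<longlonglongrightarrow> 0"
    proof (eventually_elim)
      fix x assume "x \<notin> N"
      from glim[OF this] have "(\<lambda>j. cl R (g j x)) \<longlonglongrightarrow> cl R (v x)"
        by (intro isCont_tendsto_compose[where g="cl R"])
           (use clc in \<open>auto simp: continuous_on_eq_continuous_at\<close>)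
      then have "(\<lambda>j. (vR R x - w j x)\<^sup>2) \<longlonglongrightarrow> (vR R x - vR R x)\<^sup>2"
        unfolding w_def vR_def by (intro tendsto_intros)
      then show "(\<lambda>j. (vR R x - w j x)\<^sup>2) \<longlonglongrightarrow> 0" by simp
    qed
    then show "AE x in lborel. (\<lambda>j. (vR R x - w j x)\<^sup>2) \<longlonglongrightarrow> 0"
      by (simp add: AE_completion_iff)
    fix j
    have "(vR R x - w j x)\<^sup>2 \<le> (2 * R)\<^sup>2 * indicator (cball 0 (R + 1)) x" for x
    proof (cases "x \<in> cball 0 (R + 1)")
      case True
      have "\<bar>cl R t * \<kappa> R x\<bar> \<le> R" for t
      proof -
        have "\<bar>cl R t\<bar> * \<bar>\<kappa> R x\<bar> \<le> R * 1"
          using cl_bound[OF R0] \<kappa>01[of R x] R0 by (intro mult_mono) auto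
        then show ?thesis by (simp add: abs_mult)
      qed
      from this[of "v x"] this[of "g j x"] have "\<bar>vR R x - w j x\<bar> \<le> \<bar>2 * R\<bar>"
        by (auto simp: vR_def w_def)
      then have "(vR R x - w j x)\<^sup>2 \<le> (2 * R)\<^sup>2"
        by (subst abs_le_square_iff[symmetric])
      then show ?thesis using True by simp
    qed (use wz in auto)
    then show "AE x in lborel. norm ((vR R x - w j x)\<^sup>2) \<le> (2 * R)\<^sup>2 * indicator (cball 0 (R + 1)) x"
      by auto
  qed auto
  then have "\<forall>\<^sub>F j in sequentially. (\<integral>x. (vR R x - w j x)\<^sup>2 \<partial>lborel) < e / 4"
    using \<open>0 < e\<close> by (intro order_tendstoD(2)) auto
  then obtain j where j: "(\<integral>x. (vR R x - w j x)\<^sup>2 \<partial>lborel) < e / 4"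
    by (auto simp: eventually_sequentially)
  have i1: "integrable lborel (\<lambda>x. (v x - vR R x)\<^sup>2)"
  proof (rule Bochner_Integration.integrable_bound)
    show "integrable lborel (\<lambda>x. 4 * (v x)\<^sup>2)" using v2 by auto
    have "(v x - vR R x)\<^sup>2 \<le> (2 * v x)\<^sup>2" for x
      using vR_le[OF R0, of x] by (subst abs_le_square_iff[symmetric]) auto
    then show "AE x in lborel. norm ((v x - vR R x)\<^sup>2) \<le> norm (4 * (v x)\<^sup>2)"
      by (auto simp: power2_eq_square)
  qed auto
  have i2: "integrable lborel (\<lambda>x. (vR R x - w j x)\<^sup>2)"
  proof (rule Bochner_Integration.integrable_bound)
    show "integrable lborel (\<lambda>x. 2 * (v x)\<^sup>2 + 2 * (w j x)\<^sup>2)"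
    proof (intro Bochner_Integration.integrable_add integrable_mult_right v2 continuous_bounded_support_integrable)
      show "continuous_on UNIV (\<lambda>x. (w j x)\<^sup>2)" by (intro continuous_intros wc)
      show "bounded {x. (w j x)\<^sup>2 \<noteq> 0}"
        by (rule bounded_subset[of "cball 0 (R + 1)"]) (use wz(1) in fastforce)+
    qed
    have "(vR R x - w j x)\<^sup>2 \<le> 2 * (v x)\<^sup>2 + 2 * (w j x)\<^sup>2" for x
    proof -
      have "(vR R x)\<^sup>2 \<le> (v x)\<^sup>2"
        using vR_le[OF R0, of x] by (subst abs_le_square_iff[symmetric]) auto
      moreover have "(vR R x - w j x)\<^sup>2 \<le> 2 * (vR R x)\<^sup>2 + 2 * (w j x)\<^sup>2"
        using zero_le_power2[of "vR R x + w j x"] by (simp add: power2_eq_square algebra_simps)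
      ultimately show ?thesis by simp
    qed
    then show "AE x in lborel. norm ((vR R x - w j x)\<^sup>2) \<le> norm (2 * (v x)\<^sup>2 + 2 * (w j x)\<^sup>2)"
      by auto
  qed auto
  show ?thesis
  proof (rule that[of "w j"])
    show "continuous_on UNIV (w j)" by (rule wc)
    show "bounded {x. w j x \<noteq> 0}"
      by (rule bounded_subset[of "cball 0 (R + 1)"]) (use wz(1) in fastforce)+
    have "(\<integral>\<^sup>+x. ennreal ((v x - w j x)\<^sup>2) \<partial>lborel)
        = (\<integral>\<^sup>+x. ennreal (((v x - vR R x) + (vR R x - w j x))\<^sup>2) \<partial>lborel)" by simp
    also have "\<dots> \<le> 2 * (\<integral>\<^sup>+x. ennreal ((v x - vR R x)\<^sup>2) \<partial>lborel) + 2 * (\<integral>\<^sup>+x. ennreal ((vR R x - w j x)\<^sup>2) \<partial>lborel)"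
      by (rule nn_integral_square_add_le) auto
    also have "\<dots> = ennreal (2 * (\<integral>x. (v x - vR R x)\<^sup>2 \<partial>lborel) + 2 * (\<integral>x. (vR R x - w j x)\<^sup>2 \<partial>lborel))"
      using i1 i2 by (simp add: nn_integral_eq_integral ennreal_plus ennreal_mult)
    also have "\<dots> \<le> ennreal e"
      using n j by (intro ennreal_leI) (simp add: R_def)
    finally show "(\<integral>\<^sup>+x. ennreal ((v x - w j x)\<^sup>2) \<partial>lborel) \<le> ennreal e" .
  qed
qed

lemma translation_continuous_L2:
  fixes v :: "'a::euclidean_space \<Rightarrow> real"
  assumes [measurable]: "v \<in> borel_measurable borel" and v2: "integrable lborel (\<lambda>x. (v x)\<^sup>2)" and "0 < e"
  obtains d where "0 < d" "\<And>h. norm h < d \<Longrightarrow> (\<integral>\<^sup>+x. ennreal ((v (x + h) - v x)\<^sup>2) \<partial>lborel) \<le> ennreal e"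
proof -
  \<comment> \<open>Every sum of squares costs a factor 2: two errors e/16 combine to e/4, and two
    errors e/4 to e.\<close>
  obtain w where wc: "continuous_on UNIV w" and wb: "bounded {x. w x \<noteq> 0}"
    and vw: "(\<integral>\<^sup>+x. ennreal ((v x - w x)\<^sup>2) \<partial>lborel) \<le> ennreal (e / 16)"
    using continuous_dense_L2[OF assms(1,2), of "e / 16"] \<open>0 < e\<close> by auto
  have [measurable]: "w \<in> borel_measurable borel"
    using wc by (rule borel_measurable_continuous_onI)
  obtain r where r: "0 < r" "\<And>x. w x \<noteq> 0 \<Longrightarrow> norm x \<le> r"
    using wb by (auto simp: bounded_pos)
  \<comment> \<open>Points of norm at most r + 1 stay in this ball after a shift by less than 1; for
    all other points \<open>w\<close> vanishes both before and after the shift.\<close>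
  let ?B = "cball (0::'a) (r + 2)"
  define m where "m = measure lborel ?B"
  have m0: "0 \<le> m" by (simp add: m_def)
  have Bfin: "emeasure lborel ?B = ennreal m"
    using emeasure_lborel_cball_finite[of "0::'a" "r + 2"]
    by (simp add: m_def emeasure_eq_ennreal_measure less_top[symmetric])
  \<comment> \<open>Chosen so that \<open>\<epsilon>\<^sup>2 * m \<le> e / 4\<close>; m + 1 keeps
    the denominator positive.\<close>
  define \<epsilon> where "\<epsilon> = sqrt (e / (4 * (m + 1)))"
  have e0: "0 < \<epsilon>" using \<open>0 < e\<close> m0 by (simp add: \<epsilon>_def)
  have "uniformly_continuous_on ?B w"
    using wc by (intro compact_uniformly_continuous) (auto intro: continuous_on_subset)
  then obtain d where d: "0 < d" "\<And>x y. x \<in> ?B \<Longrightarrow> y \<in> ?B \<Longrightarrow> dist y x < d \<Longrightarrow> dist (w y) (w x) < \<epsilon>"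
    using e0 unfolding uniformly_continuous_on_def by metis
  show ?thesis
  proof (rule that[of "min d 1"])
    show "0 < min d 1" using d by auto
    fix h :: 'a assume h: "norm h < min d 1"
    have pt: "(w (x + h) - w x)\<^sup>2 \<le> \<epsilon>\<^sup>2 * indicator ?B x" for x
    proof (cases "norm x \<le> r + 1")
      case True
      have "norm (x + h) \<le> norm x + norm h" by (rule norm_triangle_ineq)
      then have "x \<in> ?B" "x + h \<in> ?B" using True h by auto
      then have "\<bar>w (x + h) - w x\<bar> < \<epsilon>"
        using d(2)[of x "x + h"] h by (auto simp: dist_norm)
      then have "(w (x + h) - w x)\<^sup>2 \<le> \<epsilon>\<^sup>2"
        using e0 by (subst abs_le_square_iff[symmetric]) auto
      then show ?thesis using \<open>x \<in> ?B\<close> by simp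
    next
      case False
      have "norm x \<le> norm (x + h) + norm h" using norm_triangle_ineq4[of "x + h" h] by simp
      then have "w x = 0" "w (x + h) = 0" using False h r(2)[of x] r(2)[of "x + h"] by auto
      then show ?thesis by simp
    qed
    have "(\<integral>\<^sup>+x. ennreal ((w (x + h) - w x)\<^sup>2) \<partial>lborel) \<le> (\<integral>\<^sup>+x. ennreal (\<epsilon>\<^sup>2) * indicator ?B x \<partial>lborel)"
    proof (rule nn_integral_mono)
      fix x
      have "ennreal ((w (x + h) - w x)\<^sup>2) \<le> ennreal (\<epsilon>\<^sup>2 * indicator ?B x)"
        by (rule ennreal_leI) (rule pt)
      then show "ennreal ((w (x + h) - w x)\<^sup>2) \<le> ennreal (\<epsilon>\<^sup>2) * indicator ?B x"
        by (auto simp: indicator_def split: if_splits)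
    qed
    also have "\<dots> = ennreal (\<epsilon>\<^sup>2 * m)"
      using m0 by (simp add: nn_integral_cmult_indicator Bfin ennreal_mult)
    also have "\<dots> \<le> ennreal (e / 4)"
    proof (rule ennreal_leI)
      have "\<epsilon>\<^sup>2 * m = (e / 4) * (m / (m + 1))" using \<open>0 < e\<close> m0 by (simp add: \<epsilon>_def)
      also have "\<dots> \<le> (e / 4) * 1" using \<open>0 < e\<close> m0 by (intro mult_left_mono) (auto simp: field_simps)
      finally show "\<epsilon>\<^sup>2 * m \<le> e / 4" by simp
    qed
    finally have w: "(\<integral>\<^sup>+x. ennreal ((w (x + h) - w x)\<^sup>2) \<partial>lborel) \<le> ennreal (e / 4)" .
    have "(\<integral>\<^sup>+x. ennreal ((v (x + h) - w (x + h))\<^sup>2) \<partial>lborel) = (\<integral>\<^sup>+x. ennreal ((v x - w x)\<^sup>2) \<partial>lborel)"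
      by (rule nn_integral_lborel_translate[where f="\<lambda>x. ennreal ((v x - w x)\<^sup>2)"]) auto
    then have vh: "(\<integral>\<^sup>+x. ennreal ((v (x + h) - w (x + h))\<^sup>2) \<partial>lborel) \<le> ennreal (e / 16)" using vw by simp
    have wv: "(\<integral>\<^sup>+x. ennreal ((w x - v x)\<^sup>2) \<partial>lborel) \<le> ennreal (e / 16)"
      using vw by (simp add: power2_commute)
    have "(\<integral>\<^sup>+x. ennreal (((v (x + h) - w (x + h)) + (w x - v x))\<^sup>2) \<partial>lborel)
        \<le> 2 * (\<integral>\<^sup>+x. ennreal ((v (x + h) - w (x + h))\<^sup>2) \<partial>lborel) + 2 * (\<integral>\<^sup>+x. ennreal ((w x - v x)\<^sup>2) \<partial>lborel)"
      by (rule nn_integral_square_add_le) auto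
    also have "\<dots> \<le> 2 * ennreal (e / 16) + 2 * ennreal (e / 16)"
      by (intro add_mono mult_left_mono vh wv) auto
    also have "\<dots> = ennreal (e / 4)"
      using \<open>0 < e\<close> by (simp flip: ennreal_plus ennreal_mult ennreal_numeral)
    finally have b: "(\<integral>\<^sup>+x. ennreal (((v (x + h) - w (x + h)) + (w x - v x))\<^sup>2) \<partial>lborel) \<le> ennreal (e / 4)" .
    have "(\<integral>\<^sup>+x. ennreal ((v (x + h) - v x)\<^sup>2) \<partial>lborel)
        = (\<integral>\<^sup>+x. ennreal ((((v (x + h) - w (x + h)) + (w x - v x)) + (w (x + h) - w x))\<^sup>2) \<partial>lborel)"
      by simp
    also have "\<dots> \<le> 2 * (\<integral>\<^sup>+x. ennreal (((v (x + h) - w (x + h)) + (w x - v x))\<^sup>2) \<partial>lborel)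
         + 2 * (\<integral>\<^sup>+x. ennreal ((w (x + h) - w x)\<^sup>2) \<partial>lborel)"
      by (rule nn_integral_square_add_le) auto
    also have "\<dots> \<le> 2 * ennreal (e / 4) + 2 * ennreal (e / 4)"
      by (intro add_mono mult_left_mono b w) auto
    also have "\<dots> = ennreal e"
      using \<open>0 < e\<close> by (simp flip: ennreal_plus ennreal_mult ennreal_numeral)
    finally show "(\<integral>\<^sup>+x. ennreal ((v (x + h) - v x)\<^sup>2) \<partial>lborel) \<le> ennreal e" .
  qed
qed

section \<open>Weak gradients and translations\<close>

text \<open>Mollifiers with exactly the regularity that \<open>test_fun\<close> demands. The
  gradient is carried along as a vector field because the weak gradient will be tested in arbitrary
  directions.\<close>

definition C1_kernel :: "('a::euclidean_space \<Rightarrow> real) \<Rightarrow> ('a \<Rightarrow> 'a) \<Rightarrow> bool" where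
  "C1_kernel K G \<longleftrightarrow> (\<forall>x. (K has_derivative (\<lambda>h. G x \<bullet> h)) (at x)) \<and> continuous_on UNIV G
     \<and> bounded {x. K x \<noteq> 0} \<and> (\<forall>x. 0 \<le> K x) \<and> (\<integral>x. K x \<partial>lborel) = 1"

lemma C1_kernel_continuous: "C1_kernel K G \<Longrightarrow> continuous_on UNIV K"
  unfolding C1_kernel_def
  by (meson continuous_at_imp_continuous_on has_derivative_continuous)

lemma C1_kernel_measurable: "C1_kernel K G \<Longrightarrow> K \<in> borel_measurable borel"
  by (rule borel_measurable_continuous_onI) (rule C1_kernel_continuous)

lemma C1_kernel_integrable: "C1_kernel K G \<Longrightarrow> integrable lborel K"
  by (rule continuous_bounded_support_integrable) (auto simp: C1_kernel_continuous C1_kernel_def)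

lemma C1_kernel_integrable_square: "C1_kernel K G \<Longrightarrow> integrable lborel (\<lambda>x. (K x)\<^sup>2)"
  using C1_kernel_continuous[of K G]
  by (intro continuous_bounded_support_integrable continuous_intros) (auto simp: C1_kernel_def)

lemma has_real_derivative_max_0_square:
  "((\<lambda>s::real. (max 0 s)\<^sup>2) has_real_derivative 2 * max 0 s) (at s)"
proof -
  consider "s > 0" | "s < 0" | "s = 0" by linarith
  then show ?thesis
  proof cases
    case 1
    have "((\<lambda>s. s\<^sup>2) has_real_derivative 2 * max 0 s) (at s)"
      using 1 by (auto intro!: derivative_eq_intros)
    then show ?thesis
      by (rule has_field_derivative_transform_within[where d=s]) (use 1 in \<open>auto simp: dist_real_def\<close>)
  next
    case 2
    have "((\<lambda>s. 0) has_real_derivative 2 * max 0 s) (at s)"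
      using 2 by (auto intro!: derivative_eq_intros)
    then show ?thesis
      by (rule has_field_derivative_transform_within[where d="-s"]) (use 2 in \<open>auto simp: dist_real_def max_def\<close>)
  next
    case 3
    have "((\<lambda>h::real. max 0 h) \<longlongrightarrow> max 0 0) (at 0)"
      by (intro tendsto_intros)
    moreover have "\<forall>\<^sub>F h::real in at 0. max 0 h = (max 0 h)\<^sup>2 / h"
      by (auto simp: eventually_at max_def power2_eq_square intro!: exI[of _ 1])
    ultimately have "((\<lambda>h::real. (max 0 h)\<^sup>2 / h) \<longlongrightarrow> max 0 0) (at 0)"
      by (rule Lim_transform_eventually)
    then show ?thesis using 3 by (simp add: DERIV_def)
  qed
qed

text \<open>The profile is a squared positive part, which is C1 across the sphere of radius
  \<open>e\<close>; being a function of \<open>x \<bullet> x\<close>, it is also differentiable at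
  the origin. Dividing by its integral normalises it.\<close>

lemma C1_kernel_exists:
  assumes "0 < e"
  obtains K :: "'a::euclidean_space \<Rightarrow> real" and G
  where "C1_kernel K G" "\<And>x. K x \<noteq> 0 \<Longrightarrow> norm x < e"
proof -
  define b where "b x = (max 0 (1 - (x \<bullet> x) / e\<^sup>2))\<^sup>2" for x :: 'a
  have b0: "0 \<le> b x" for x by (simp add: b_def)
  have supp: "norm x < e" if "b x \<noteq> 0" for x
  proof -
    have "0 < 1 - (x \<bullet> x) / e\<^sup>2"
      using that by (rule contrapos_np) (simp add: b_def max_absorb1)
    then have "(norm x)\<^sup>2 < e\<^sup>2" using assms by (simp add: field_simps dot_square_norm)
    then show ?thesis using assms by (simp add: power2_less_imp_less)
  qed
  have bd: "(b has_derivative (\<lambda>h. (2 * max 0 (1 - (x \<bullet> x) / e\<^sup>2) * (- 2 / e\<^sup>2)) * (x \<bullet> h))) (at x)" for x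
  proof -
    have 1: "((\<lambda>x::'a. 1 - (x \<bullet> x) / e\<^sup>2) has_derivative (\<lambda>h. - (2 * (x \<bullet> h)) / e\<^sup>2)) (at x)"
    proof -
      have "((\<lambda>x::'a. 1 - (x \<bullet> x) * c) has_derivative (\<lambda>h. - (2 * (x \<bullet> h)) * c)) (at x)" for c
        by (auto intro!: derivative_eq_intros simp: inner_commute fun_eq_iff)
      from this[of "inverse (e\<^sup>2)"] show ?thesis by (simp add: divide_inverse)
    qed
    have 2: "((\<lambda>s::real. (max 0 s)\<^sup>2) has_derivative (\<lambda>h. (2 * max 0 (1 - (x \<bullet> x) / e\<^sup>2)) * h)) (at (1 - (x \<bullet> x) / e\<^sup>2))"
      using has_real_derivative_max_0_square by (simp add: has_field_derivative_def)
    from has_derivative_compose[OF 1 2] show ?thesis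
      unfolding b_def by (rule has_derivative_eq_rhs) (auto simp: fun_eq_iff)
  qed
  have bc: "continuous_on UNIV b" unfolding b_def using assms by (intro continuous_intros) auto
  have bb: "bounded {x. b x \<noteq> 0}"
    by (rule bounded_subset[of "ball 0 e"]) (use supp in auto)
  have bi: "integrable lborel b" by (rule continuous_bounded_support_integrable[OF bc bb])
  define c where "c = (\<integral>x. b x \<partial>lborel)"
  have "c > 0"
  proof -
    have "c \<ge> 0" using b0 by (simp add: c_def integral_nonneg_AE)
    moreover have "c \<noteq> 0"
    proof
      assume "c = 0"
      then have "AE x in lborel. b x = 0"
        using integral_nonneg_eq_0_iff_AE[OF bi] b0 by (simp add: c_def)
      then have "AE x in lborel. x \<notin> ball (0::'a) e"
      proof eventually_elim
        fix x assume "b x = 0"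
        then have "\<not> 0 < 1 - (x \<bullet> x) / e\<^sup>2" by (auto simp: b_def)
        then have "\<not> (norm x)\<^sup>2 < e\<^sup>2" using assms by (simp add: field_simps dot_square_norm)
        then have "e \<le> norm x" by (meson norm_ge_zero not_less power_strict_mono zero_less_numeral)
        then show "x \<notin> ball 0 e" by simp
      qed
      then have "emeasure lborel (ball (0::'a) e) = 0"
        by (subst (asm) AE_iff_measurable[of "ball 0 e"]) auto
      then have "measure lborel (ball (0::'a) e) = 0" by (simp add: measure_def)
      then show False using assms by simp
    qed
    ultimately show ?thesis by simp
  qed
  show ?thesis
  proof (rule that[of "\<lambda>x. b x / c" "\<lambda>x. ((2 * max 0 (1 - (x \<bullet> x) / e\<^sup>2) * (- 2 / e\<^sup>2)) / c) *\<^sub>R x"])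
    show "C1_kernel (\<lambda>x. b x / c) (\<lambda>x. ((2 * max 0 (1 - (x \<bullet> x) / e\<^sup>2) * (- 2 / e\<^sup>2)) / c) *\<^sub>R x)"
      unfolding C1_kernel_def
    proof (intro conjI allI)
      show "((\<lambda>x. b x / c) has_derivative (\<lambda>h. ((2 * max 0 (1 - (x \<bullet> x) / e\<^sup>2) * (- 2 / e\<^sup>2)) / c) *\<^sub>R x \<bullet> h)) (at x)" for x
        unfolding divide_inverse
        by (rule has_derivative_eq_rhs, rule has_derivative_mult_left[OF bd[unfolded divide_inverse]])
           (auto simp: fun_eq_iff)
      show "continuous_on UNIV (\<lambda>x. ((2 * max 0 (1 - (x \<bullet> x) / e\<^sup>2) * (- 2 / e\<^sup>2)) / c) *\<^sub>R (x::'a))"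
        using \<open>c > 0\<close> assms by (intro continuous_intros) auto
      show "bounded {x. b x / c \<noteq> 0}" using bb \<open>c > 0\<close> by simp
      show "0 \<le> b x / c" for x using b0 \<open>c > 0\<close> by simp
      show "(\<integral>x. b x / c \<partial>lborel) = 1" using \<open>c > 0\<close> by (simp add: c_def)
    qed
    show "norm x < e" if "b x / c \<noteq> 0" for x using that supp[of x] by auto
  qed
qed

text \<open>Reduces an L2 bound for \<open>v\<close> to one for its mollifications, where
  integration by parts is available. The difference between \<open>v\<close> and its mollification
  is an average of small translation differences; the factor 2 is the cost of squaring a sum of two
  terms.\<close>

lemma nn_integral_square_le_of_mollified:
  fixes v :: "'a::euclidean_space \<Rightarrow> real"
  assumes [measurable]: "v \<in> borel_measurable borel" and v2: "integrable lborel (\<lambda>x. (v x)\<^sup>2)"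
    and le: "\<And>K G. C1_kernel K G \<Longrightarrow> (\<integral>\<^sup>+x. ennreal ((\<integral>z. K z * v (x + z) \<partial>lborel)\<^sup>2) \<partial>lborel) \<le> c"
  shows "(\<integral>\<^sup>+x. ennreal ((v x)\<^sup>2) \<partial>lborel) \<le> 2 * c"
proof (rule ennreal_le_epsilon)
  fix e :: real assume "0 < e"
  then obtain d where d: "0 < d"
    "\<And>h. norm h < d \<Longrightarrow> (\<integral>\<^sup>+x. ennreal ((v (x + h) - v x)\<^sup>2) \<partial>lborel) \<le> ennreal (e / 2)"
    using translation_continuous_L2[OF assms(1,2), of "e / 2"] by auto
  obtain K :: "'a \<Rightarrow> real" and G where K: "C1_kernel K G" "\<And>x. K x \<noteq> 0 \<Longrightarrow> norm x < d"
    using C1_kernel_exists[OF d(1)] by blast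
  have [measurable]: "K \<in> borel_measurable borel" by (rule C1_kernel_measurable[OF K(1)])
  have Ki: "integrable lborel K" by (rule C1_kernel_integrable[OF K(1)])
  have K1: "(\<integral>x. K x \<partial>lborel) = 1" using K(1) by (simp add: C1_kernel_def)
  have K0: "0 \<le> K x" for x using K(1) by (simp add: C1_kernel_def)
  have Kv: "integrable lborel (\<lambda>z. K z * v (x + z))" for x
    using integrable_lborel_translate[OF v2, of x]
    by (intro integrable_mult_L2 C1_kernel_integrable_square[OF K(1)]) (auto simp: add.commute)
  define w where "w x = (\<integral>z. K z * v (x + z) \<partial>lborel)" for x
  have [measurable]: "w \<in> borel_measurable borel" unfolding w_def by measurable
  have "(\<integral>\<^sup>+x. ennreal ((w x - v x)\<^sup>2) \<partial>lborel)
      = (\<integral>\<^sup>+x. ennreal ((\<integral>z. K z * (v (x + z) - v x) \<partial>lborel)\<^sup>2) \<partial>lborel)"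
  proof (rule nn_integral_cong)
    fix x
    have "(\<integral>z. K z * (v (x + z) - v x) \<partial>lborel) = (\<integral>z. K z * v (x + z) - K z * v x \<partial>lborel)"
      by (simp add: algebra_simps)
    also have "\<dots> = w x - v x"
      using Kv[of x] Ki K1 by (simp add: w_def)
    finally show "ennreal ((w x - v x)\<^sup>2) = ennreal ((\<integral>z. K z * (v (x + z) - v x) \<partial>lborel)\<^sup>2)" by simp
  qed
  also have "\<dots> \<le> ennreal (e / 2)"
    by (rule nn_integral_weighted_mean_square_le[OF Ki K0 K1]) (use d(2) K(2) in auto)
  finally have wv: "(\<integral>\<^sup>+x. ennreal ((v x - w x)\<^sup>2) \<partial>lborel) \<le> ennreal (e / 2)"
    by (simp add: power2_commute)
  have "(\<integral>\<^sup>+x. ennreal ((v x)\<^sup>2) \<partial>lborel) = (\<integral>\<^sup>+x. ennreal ((w x + (v x - w x))\<^sup>2) \<partial>lborel)" by simp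
  also have "\<dots> \<le> 2 * (\<integral>\<^sup>+x. ennreal ((w x)\<^sup>2) \<partial>lborel) + 2 * (\<integral>\<^sup>+x. ennreal ((v x - w x)\<^sup>2) \<partial>lborel)"
    by (rule nn_integral_square_add_le) auto
  also have "\<dots> \<le> 2 * c + 2 * ennreal (e / 2)"
    using le[OF K(1)] by (intro add_mono mult_left_mono wv) (auto simp: w_def)
  also have "2 * ennreal (e / 2) = ennreal e"
    using \<open>0 < e\<close> by (simp flip: ennreal_mult ennreal_numeral)
  finally show "(\<integral>\<^sup>+x. ennreal ((v x)\<^sup>2) \<partial>lborel) \<le> 2 * c + ennreal e" .
qed

lemma C1_kernel_test_fun:
  assumes "C1_kernel K G"
  shows "test_fun (\<lambda>y. K (y - x)) (\<lambda>y h. G (y - x) \<bullet> h)"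
  unfolding test_fun_def
proof (intro conjI allI ballI)
  fix y
  have "((\<lambda>y. K (y - x)) has_derivative (\<lambda>h. G (y - x) \<bullet> h)) (at y)"
    by (rule has_derivative_compose[of "\<lambda>y. y - x" "\<lambda>h. h" y UNIV K "\<lambda>h. G (y - x) \<bullet> h"])
       (use assms in \<open>auto simp: C1_kernel_def intro!: derivative_eq_intros\<close>)
  then show "((\<lambda>y. K (y - x)) has_derivative (\<bullet>) (G (y - x))) (at y)" .
next
  fix i :: 'a
  show "continuous_on UNIV (\<lambda>y. G (y - x) \<bullet> i)"
    using assms by (auto intro!: continuous_intros continuous_on_compose2[of UNIV G] simp: C1_kernel_def)
next
  have "{y. K (y - x) \<noteq> 0} = (\<lambda>z. x + z) ` {z. K z \<noteq> 0}"
    by (auto simp: image_iff) (metis add.commute diff_add_cancel)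
  then show "bounded {y. K (y - x) \<noteq> 0}"
    using assms by (simp add: C1_kernel_def bounded_translation)
qed

lemma C1_kernel_gradient_support:
  assumes "C1_kernel K G"
  shows "bounded {x. G x \<noteq> 0}"
proof -
  obtain r where r: "\<And>x. K x \<noteq> 0 \<Longrightarrow> norm x \<le> r"
    using assms by (auto simp: C1_kernel_def bounded_iff)
  have "norm x \<le> r" if "G x \<noteq> 0" for x
  proof (rule ccontr)
    assume x: "\<not> norm x \<le> r"
    have "(K has_derivative (\<lambda>h. 0)) (at x)"
    proof (rule has_derivative_transform_within_open[of "\<lambda>x. 0" "\<lambda>h. 0" x UNIV "- cball 0 r"])
      show "0 = K y" if "y \<in> - cball 0 r" for y using that r[of y] by auto
    qed (use x in auto)
    moreover have "(K has_derivative (\<lambda>h. G x \<bullet> h)) (at x)"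
      using assms by (simp add: C1_kernel_def)
    ultimately have "(\<lambda>h. G x \<bullet> h) = (\<lambda>h. 0)" by (metis has_derivative_unique)
    then have "G x \<bullet> G x = 0" by meson
    then show False using that by simp
  qed
  then show ?thesis by (auto simp: bounded_iff)
qed

text \<open>The test function is \<open>y \<mapsto> K (y - x)\<close>, followed by a change of
  variables. The definition of weak gradient covers only basis directions, so a general
  \<open>h\<close> is reached by expanding it in the basis.\<close>

lemma weak_gradient_C1_kernel:
  fixes u :: "'a::euclidean_space \<Rightarrow> real"
  assumes um[measurable]: "u \<in> borel_measurable borel" and u2: "integrable lborel (\<lambda>x. (u x)\<^sup>2)"
    and gm[measurable]: "g \<in> borel_measurable borel" and g2: "integrable lborel (\<lambda>x. (norm (g x))\<^sup>2)"
    and wg: "weak_gradient u g" and K: "C1_kernel K G"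
  shows "(\<integral>z. u (x + z) * (G z \<bullet> h) \<partial>lborel) = - (\<integral>z. K z * (g (x + z) \<bullet> h) \<partial>lborel)"
proof -
  have [measurable]: "K \<in> borel_measurable borel" by (rule C1_kernel_measurable[OF K])
  have Gc: "continuous_on UNIV G" using K by (simp add: C1_kernel_def)
  have [measurable]: "G \<in> borel_measurable borel"
    using Gc by (rule borel_measurable_continuous_onI)
  have G2: "integrable lborel (\<lambda>x. (G x \<bullet> i)\<^sup>2)" for i
  proof (rule continuous_bounded_support_integrable)
    show "continuous_on UNIV (\<lambda>x. (G x \<bullet> i)\<^sup>2)" by (intro continuous_intros Gc)
    show "bounded {x. (G x \<bullet> i)\<^sup>2 \<noteq> 0}"
      by (rule bounded_subset[OF C1_kernel_gradient_support[OF K]]) auto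
  qed
  have gi2: "integrable lborel (\<lambda>x. (g x \<bullet> i)\<^sup>2)" for i
  proof (rule Bochner_Integration.integrable_bound)
    show "integrable lborel (\<lambda>x. (norm i)\<^sup>2 * (norm (g x))\<^sup>2)" using g2 by auto
    have "(g x \<bullet> i)\<^sup>2 \<le> (norm i * norm (g x))\<^sup>2" for x
      using Cauchy_Schwarz_ineq2[of "g x" i] by (subst abs_le_square_iff[symmetric]) (simp add: mult.commute)
    then show "AE x in lborel. norm ((g x \<bullet> i)\<^sup>2) \<le> norm ((norm i)\<^sup>2 * (norm (g x))\<^sup>2)"
      by (simp add: power_mult_distrib)
  qed auto
  have i1: "integrable lborel (\<lambda>z. u (x + z) * (G z \<bullet> i))" for i
    using integrable_lborel_translate[OF u2, of x] G2[of i]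
    by (intro integrable_mult_L2) (auto simp: add.commute)
  have i2: "integrable lborel (\<lambda>z. K z * (g (x + z) \<bullet> i))" for i
    using integrable_lborel_translate[OF gi2[of i], of x]
    by (intro integrable_mult_L2 C1_kernel_integrable_square[OF K]) (auto simp: add.commute)
  have basis: "(\<integral>z. u (x + z) * (G z \<bullet> i) \<partial>lborel) = - (\<integral>z. K z * (g (x + z) \<bullet> i) \<partial>lborel)" if "i \<in> Basis" for i
  proof -
    have "(\<integral>y. u y * (G (y - x) \<bullet> i) \<partial>lborel) = - (\<integral>y. (g y \<bullet> i) * K (y - x) \<partial>lborel)"
      using wg C1_kernel_test_fun[OF K, of x] that unfolding weak_gradient_def by blast
    moreover have "(\<integral>z. u (z + x) * (G (z + x - x) \<bullet> i) \<partial>lborel) = (\<integral>y. u y * (G (y - x) \<bullet> i) \<partial>lborel)"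
      by (rule integral_lborel_translate) auto
    moreover have "(\<integral>z. (g (z + x) \<bullet> i) * K (z + x - x) \<partial>lborel) = (\<integral>y. (g y \<bullet> i) * K (y - x) \<partial>lborel)"
      by (rule integral_lborel_translate) auto
    ultimately show ?thesis by (simp add: ac_simps)
  qed
  have "(\<integral>z. u (x + z) * (G z \<bullet> h) \<partial>lborel) = (\<integral>z. (\<Sum>i\<in>Basis. (h \<bullet> i) * (u (x + z) * (G z \<bullet> i))) \<partial>lborel)"
    by (subst euclidean_inner) (simp add: sum_distrib_left ac_simps)
  also have "\<dots> = (\<Sum>i\<in>Basis. (h \<bullet> i) * (\<integral>z. u (x + z) * (G z \<bullet> i) \<partial>lborel))"
    using i1 by (subst Bochner_Integration.integral_sum) auto
  also have "\<dots> = (\<Sum>i\<in>Basis. - ((h \<bullet> i) * (\<integral>z. K z * (g (x + z) \<bullet> i) \<partial>lborel)))"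
    by (intro sum.cong) (auto simp: basis)
  also have "\<dots> = - (\<Sum>i\<in>Basis. (h \<bullet> i) * (\<integral>z. K z * (g (x + z) \<bullet> i) \<partial>lborel))"
    by (simp add: sum_negf)
  also have "(\<Sum>i\<in>Basis. (h \<bullet> i) * (\<integral>z. K z * (g (x + z) \<bullet> i) \<partial>lborel))
     = (\<integral>z. (\<Sum>i\<in>Basis. (h \<bullet> i) * (K z * (g (x + z) \<bullet> i))) \<partial>lborel)"
    using i2 by (subst Bochner_Integration.integral_sum) auto
  also have "\<dots> = (\<integral>z. K z * (g (x + z) \<bullet> h) \<partial>lborel)"
    by (subst (2) euclidean_inner) (simp add: sum_distrib_left ac_simps)
  finally show ?thesis .
qed

text \<open>Averaging a kernel over the segment from \<open>0\<close> to \<open>h\<close> turns a difference along \<open>h\<close> into a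
  directional derivative, so that the weak gradient can be tested against it.\<close>

lemma C1_kernel_segment_average:
  fixes K :: "'a::euclidean_space \<Rightarrow> real"
  assumes K: "C1_kernel K G"
  obtains K' G' where "C1_kernel K' G'" "\<And>y. G' y \<bullet> h = K y - K (y - h)"
proof -
  have Kc: "continuous_on UNIV K" by (rule C1_kernel_continuous[OF K])
  have Gc: "continuous_on UNIV G" using K by (simp add: C1_kernel_def)
  have Kd: "(K has_derivative (\<lambda>h. G x \<bullet> h)) (at x)" for x using K by (simp add: C1_kernel_def)
  have K0: "0 \<le> K x" for x using K by (simp add: C1_kernel_def)
  have [measurable]: "K \<in> borel_measurable borel" by (rule C1_kernel_measurable[OF K])
  have Kc2: "continuous_on S (\<lambda>s. K (y s - t s *\<^sub>R h))" if "continuous_on S y" "continuous_on S t" for S :: "'c::topological_space set" and y t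
    by (rule continuous_on_compose2[OF Kc]) (auto intro!: continuous_intros that)
  have Gc2: "continuous_on S (\<lambda>s. G (y s - t s *\<^sub>R h))" if "continuous_on S y" "continuous_on S t" for S :: "'c::topological_space set" and y t
    by (rule continuous_on_compose2[OF Gc]) (auto intro!: continuous_intros that)
  define P where "P y = integral (cbox 0 1) (\<lambda>s::real. K (y - s *\<^sub>R h))" for y
  define Q where "Q y = integral (cbox 0 1) (\<lambda>s::real. G (y - s *\<^sub>R h))" for y
  have Gi: "(\<lambda>s::real. G (y - s *\<^sub>R h)) integrable_on cbox 0 1" for y
    by (rule integrable_continuous) (intro Gc2 continuous_intros)
  have Ki: "(\<lambda>s::real. K (y - s *\<^sub>R h)) integrable_on cbox 0 1" for y
    by (rule integrable_continuous) (intro Kc2 continuous_intros)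
  have Pd: "(P has_derivative (\<lambda>k. Q y \<bullet> k)) (at y)" for y
  proof -
    \<comment> \<open>Differentiation under the integral sign; the derivative is written through
      \<open>blinfun_inner_right\<close> so that it becomes an integral with values in bounded
      linear maps.\<close>
    have "((\<lambda>y. integral (cbox 0 1) (\<lambda>s::real. K (y - s *\<^sub>R h))) has_derivative
        blinfun_apply (integral (cbox 0 1) (\<lambda>s::real. blinfun_inner_right (G (y - s *\<^sub>R h))))) (at y within UNIV)"
    proof (rule leibniz_rule)
      fix x t
      show "((\<lambda>x. K (x - t *\<^sub>R h)) has_derivative blinfun_apply (blinfun_inner_right (G (x - t *\<^sub>R h)))) (at x within UNIV)"
        by (rule has_derivative_compose[of "\<lambda>y. y - t *\<^sub>R h" "\<lambda>h. h", OF _ Kd, THEN has_derivative_eq_rhs])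
           (auto intro!: derivative_eq_intros simp: fun_eq_iff)
    next
      have "continuous_on (UNIV \<times> cbox 0 1) (\<lambda>p. G (fst p - snd p *\<^sub>R h))"
        by (intro Gc2 continuous_intros)
      then show "continuous_on (UNIV \<times> cbox 0 1) (\<lambda>(x, t). blinfun_inner_right (G (x - t *\<^sub>R h)))"
        unfolding split_beta
        by (intro bounded_linear.continuous_on[OF bounded_linear_blinfun_inner_right])
    qed (use Ki in auto)
    moreover have "blinfun_apply (integral (cbox 0 1) (\<lambda>s::real. blinfun_inner_right (G (y - s *\<^sub>R h)))) = (\<lambda>k. Q y \<bullet> k)"
    proof -
      have "integral (cbox 0 1) (\<lambda>s::real. blinfun_inner_right (G (y - s *\<^sub>R h))) = blinfun_inner_right (Q y)"
        using integral_linear[OF Gi[of y] bounded_linear_blinfun_inner_right] by (simp add: Q_def o_def)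
      then show ?thesis by (simp add: fun_eq_iff)
    qed
    ultimately show ?thesis unfolding P_def by simp
  qed
  have Qc: "continuous_on UNIV Q"
    unfolding Q_def
    by (rule integral_continuous_on_param) (auto simp: split_beta intro!: Gc2 continuous_intros)
  obtain r where r: "\<And>x. K x \<noteq> 0 \<Longrightarrow> norm x \<le> r"
    using K by (auto simp: C1_kernel_def bounded_iff)
  have supp: "norm y \<le> r + norm h" if "P y \<noteq> 0" for y
  proof (rule ccontr)
    assume y: "\<not> norm y \<le> r + norm h"
    have "K (y - s *\<^sub>R h) = 0" if "s \<in> cbox 0 1" for s
    proof -
      have "norm (s *\<^sub>R h) \<le> norm h" using that by (auto simp: mult_left_le_one_le)
      then have "norm (y - s *\<^sub>R h) > r" using y norm_triangle_ineq2[of y "s *\<^sub>R h"] by linarith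
      then show ?thesis using r by force
    qed
    then have "P y = integral (cbox 0 1) (\<lambda>s::real. 0)" unfolding P_def by (intro integral_cong)
    then show False using that by simp
  qed
  have Pb: "bounded {y. P y \<noteq> 0}" using supp by (auto simp: bounded_iff)
  have P0: "0 \<le> P y" for y unfolding P_def by (intro integral_nonneg Ki K0)
  have Pc: "continuous_on UNIV P"
    by (meson Pd continuous_at_imp_continuous_on has_derivative_continuous)
  have Pi: "integrable lborel P" by (rule continuous_bounded_support_integrable[OF Pc Pb])
  have [measurable]: "P \<in> borel_measurable borel" using Pc by (rule borel_measurable_continuous_onI)
  \<comment> \<open>\<open>P\<close> has total mass 1 by Tonelli, since each translate of
    \<open>K\<close> has mass 1.\<close>
  have "(\<integral>\<^sup>+y. ennreal (P y) \<partial>lborel) = (\<integral>\<^sup>+y. (\<integral>\<^sup>+s. ennreal (K (y - s *\<^sub>R h)) * indicator (cbox 0 1) s \<partial>lborel) \<partial>lborel)"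
  proof (rule nn_integral_cong)
    fix y
    have "((\<lambda>s::real. K (y - s *\<^sub>R h)) has_integral P y) (cbox 0 1)"
      unfolding P_def by (rule integrable_integral[OF Ki])
    then show "ennreal (P y) = (\<integral>\<^sup>+s. ennreal (K (y - s *\<^sub>R h)) * indicator (cbox 0 1) s \<partial>lborel)"
      by (intro nn_integral_has_integral_lebesgue'[symmetric]) (auto simp: K0)
  qed
  also have "\<dots> = (\<integral>\<^sup>+s. (\<integral>\<^sup>+y. ennreal (K (y - s *\<^sub>R h)) * indicator (cbox 0 1) s \<partial>lborel) \<partial>lborel)"
    by (intro lborel_pair.Fubini'[symmetric]) measurable
  also have "\<dots> = (\<integral>\<^sup>+s. indicator (cbox 0 (1::real)) s \<partial>lborel)"
  proof (rule nn_integral_cong)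
    fix s :: real
    have "(\<integral>\<^sup>+y. ennreal (K (y - s *\<^sub>R h)) \<partial>lborel) = (\<integral>\<^sup>+y. ennreal (K y) \<partial>lborel)"
      using nn_integral_lborel_translate[of "\<lambda>y. ennreal (K y)" "- s *\<^sub>R h"] by simp
    also have "\<dots> = 1"
      using K C1_kernel_integrable[OF K] by (subst nn_integral_eq_integral) (auto simp: C1_kernel_def)
    finally show "(\<integral>\<^sup>+y. ennreal (K (y - s *\<^sub>R h)) * indicator (cbox 0 1) s \<partial>lborel) = indicator (cbox 0 1) s"
      by (simp add: nn_integral_multc)
  qed
  also have "\<dots> = 1" by simp
  finally have "ennreal (\<integral>y. P y \<partial>lborel) = 1"
    using nn_integral_eq_integral[OF Pi] P0 by simp
  then have P1: "(\<integral>y. P y \<partial>lborel) = 1" by simp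
  \<comment> \<open>The fundamental theorem of calculus along the segment from \<open>y\<close> to
    \<open>y - h\<close>.\<close>
  have Qh: "Q y \<bullet> h = K y - K (y - h)" for y
  proof -
    have "((\<lambda>s. K (y - s *\<^sub>R h)) has_vector_derivative - (G (y - s *\<^sub>R h) \<bullet> h)) (at s within {0..1})" for s
      unfolding has_vector_derivative_def
      by (rule has_derivative_compose[of "\<lambda>s. y - s *\<^sub>R h" "\<lambda>s. - s *\<^sub>R h", OF _ Kd, THEN has_derivative_eq_rhs])
         (auto intro!: derivative_eq_intros simp: fun_eq_iff)
    then have "((\<lambda>s. - (G (y - s *\<^sub>R h) \<bullet> h)) has_integral K (y - 1 *\<^sub>R h) - K (y - 0 *\<^sub>R h)) {0..1}"
      by (intro fundamental_theorem_of_calculus) auto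
    then have "((\<lambda>s. G (y - s *\<^sub>R h) \<bullet> h) has_integral K y - K (y - h)) {0..1}"
      by (auto dest: has_integral_neg)
    moreover have "((\<lambda>s. G (y - s *\<^sub>R h) \<bullet> h) has_integral Q y \<bullet> h) {0..1}"
      using has_integral_linear[OF integrable_integral[OF Gi[of y]] bounded_linear_inner_left[of h]]
      by (simp add: Q_def o_def)
    ultimately show ?thesis by (metis has_integral_unique)
  qed
  show ?thesis
    by (rule that[of P Q]) (auto simp: C1_kernel_def Pd Qc Pb P0 P1 Qh)
qed

text \<open>After mollification by \<open>K\<close>, the difference along \<open>h\<close> is the
  average of the directional derivative \<open>g \<bullet> h\<close> against the segment-averaged
  kernel; Jensen and Cauchy-Schwarz then give the bound without the factor 2, which comes back with
  the removal of the mollifier.\<close>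

lemma nn_integral_translation_difference_le:
  fixes u :: "'a::euclidean_space \<Rightarrow> real"
  assumes um[measurable]: "u \<in> borel_measurable borel" and u2: "integrable lborel (\<lambda>x. (u x)\<^sup>2)"
    and gm[measurable]: "g \<in> borel_measurable borel" and g2: "integrable lborel (\<lambda>x. (norm (g x))\<^sup>2)"
    and wg: "weak_gradient u g"
  shows "(\<integral>\<^sup>+x. ennreal ((u (x + h) - u x)\<^sup>2) \<partial>lborel) \<le> ennreal (2 * (norm h)\<^sup>2 * (\<integral>x. (norm (g x))\<^sup>2 \<partial>lborel))"
proof -
  define c where "c = ennreal ((norm h)\<^sup>2 * (\<integral>x. (norm (g x))\<^sup>2 \<partial>lborel))"
  have uh2: "integrable lborel (\<lambda>x. (u (x + h))\<^sup>2)"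
    using integrable_lborel_translate[OF u2] .
  have "(\<integral>\<^sup>+x. ennreal ((u (x + h) - u x)\<^sup>2) \<partial>lborel) \<le> 2 * c"
  proof (rule nn_integral_square_le_of_mollified)
    have "integrable lborel (\<lambda>x. (u (x + h))\<^sup>2 + (u x)\<^sup>2 - 2 * (u (x + h) * u x))"
      by (intro Bochner_Integration.integrable_diff Bochner_Integration.integrable_add integrable_mult_right integrable_mult_L2 uh2 u2) auto
    then show "integrable lborel (\<lambda>x. (u (x + h) - u x)\<^sup>2)"
      by (simp add: power2_diff algebra_simps)
    fix K :: "'a \<Rightarrow> real" and G assume K: "C1_kernel K G"
    have [measurable]: "K \<in> borel_measurable borel" by (rule C1_kernel_measurable[OF K])
    obtain K' G' where K': "C1_kernel K' G'" and G': "\<And>y. G' y \<bullet> h = K y - K (y - h)"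
      using C1_kernel_segment_average[OF K] by blast
    have Ku: "integrable lborel (\<lambda>z. K z * u (x + z))" for x
      using integrable_lborel_translate[OF u2, of x]
      by (intro integrable_mult_L2 C1_kernel_integrable_square[OF K]) (auto simp: add.commute)
    have eq: "(\<integral>z. K z * (u (x + z + h) - u (x + z)) \<partial>lborel) = (\<integral>z. K' z * (g (x + z) \<bullet> h) \<partial>lborel)" for x
    proof -
      have Kh: "integrable lborel (\<lambda>z. K (z - h) * u (x + z))"
        using integrable_lborel_translate[OF Ku[of "x + h"], of "-h"] by (simp add: algebra_simps)
      have "(\<integral>z. K z * u (x + z + h) \<partial>lborel) = (\<integral>z. K (z + h - h) * u (x + (z + h)) \<partial>lborel)"
        by (simp add: algebra_simps)
      also have "\<dots> = (\<integral>z. K (z - h) * u (x + z) \<partial>lborel)"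
        by (rule integral_lborel_translate) auto
      finally have 1: "(\<integral>z. K z * u (x + z + h) \<partial>lborel) = (\<integral>z. K (z - h) * u (x + z) \<partial>lborel)" .
      have Ku': "integrable lborel (\<lambda>z. K z * u (x + z + h))"
        using Ku[of "x + h"] by (simp add: algebra_simps)
      have "(\<integral>z. K z * (u (x + z + h) - u (x + z)) \<partial>lborel)
        = (\<integral>z. K z * u (x + z + h) \<partial>lborel) - (\<integral>z. K z * u (x + z) \<partial>lborel)"
        using Ku' Ku[of x] by (simp add: right_diff_distrib)
      \<comment> \<open>The shift by \<open>h\<close> has been moved onto the kernel. The sign that
        appears here cancels the one from integration by parts.\<close>
      also have "\<dots> = - (\<integral>z. u (x + z) * (K z - K (z - h)) \<partial>lborel)"
        using Kh Ku[of x] by (simp add: 1 right_diff_distrib mult.commute)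
      also have "\<dots> = (\<integral>z. K' z * (g (x + z) \<bullet> h) \<partial>lborel)"
        using weak_gradient_C1_kernel[OF um u2 gm g2 wg K', of x h] by (simp add: G')
      finally show ?thesis .
    qed
    have "(\<integral>\<^sup>+x. ennreal ((\<integral>z. K z * (u (x + z + h) - u (x + z)) \<partial>lborel)\<^sup>2) \<partial>lborel)
       = (\<integral>\<^sup>+x. ennreal ((\<integral>z. K' z * (g (x + z) \<bullet> h) \<partial>lborel)\<^sup>2) \<partial>lborel)"
      by (simp add: eq)
    also have "\<dots> \<le> c"
    proof (rule nn_integral_weighted_mean_square_le)
      fix z
      have "(\<integral>\<^sup>+x. ennreal ((g (x + z) \<bullet> h)\<^sup>2) \<partial>lborel) = (\<integral>\<^sup>+x. ennreal ((g x \<bullet> h)\<^sup>2) \<partial>lborel)"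
        by (rule nn_integral_lborel_translate[where f="\<lambda>x. ennreal ((g x \<bullet> h)\<^sup>2)"]) auto
      also have "\<dots> \<le> (\<integral>\<^sup>+x. ennreal ((norm h)\<^sup>2 * (norm (g x))\<^sup>2) \<partial>lborel)"
      proof (intro nn_integral_mono ennreal_leI)
        fix x
        have "(g x \<bullet> h)\<^sup>2 \<le> (norm h * norm (g x))\<^sup>2"
          using Cauchy_Schwarz_ineq2[of "g x" h] by (subst abs_le_square_iff[symmetric]) (simp add: mult.commute)
        then show "(g x \<bullet> h)\<^sup>2 \<le> (norm h)\<^sup>2 * (norm (g x))\<^sup>2" by (simp add: power_mult_distrib)
      qed
      also have "\<dots> = c"
        using g2 by (subst nn_integral_eq_integral) (auto simp: c_def)
      finally show "(\<integral>\<^sup>+x. ennreal ((g (x + z) \<bullet> h)\<^sup>2) \<partial>lborel) \<le> c" .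
    qed (use K' C1_kernel_integrable[OF K'] in \<open>auto simp: C1_kernel_def\<close>)
    finally show "(\<integral>\<^sup>+x. ennreal ((\<integral>z. K z * (u (x + z + h) - u (x + z)) \<partial>lborel)\<^sup>2) \<partial>lborel) \<le> c" .
  qed auto
  also have "2 * c = ennreal (2 * (norm h)\<^sup>2 * (\<integral>x. (norm (g x))\<^sup>2 \<partial>lborel))"
    by (simp add: c_def ennreal_mult' mult.assoc)
  finally show ?thesis .
qed

text \<open>All mollifications of a component of \<open>g - g'\<close> vanish, so its L2 norm does.
  This is what makes \<open>grad\<close>, a chosen representative, compatible with scaling.\<close>

lemma weak_gradient_unique:
  fixes u :: "'a::euclidean_space \<Rightarrow> real"
  assumes g[measurable]: "g \<in> borel_measurable borel" "integrable lborel (\<lambda>x. (norm (g x))\<^sup>2)" "weak_gradient u g"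
    and g'[measurable]: "g' \<in> borel_measurable borel" "integrable lborel (\<lambda>x. (norm (g' x))\<^sup>2)" "weak_gradient u g'"
  shows "AE x in lborel. g x = g' x"
proof -
  have "AE x in lborel. (g x - g' x) \<bullet> i = 0" if i: "i \<in> Basis" for i
  proof -
    define v where "v x = (g x - g' x) \<bullet> i" for x
    have [measurable]: "v \<in> borel_measurable borel" unfolding v_def by measurable
    have c2: "integrable lborel (\<lambda>x. (f x \<bullet> i)\<^sup>2)"
      if [measurable]: "f \<in> borel_measurable borel" and "integrable lborel (\<lambda>x. (norm (f x))\<^sup>2)" for f :: "'a \<Rightarrow> 'a"
    proof (rule Bochner_Integration.integrable_bound[OF that(2)])
      have "(f x \<bullet> i)\<^sup>2 \<le> (norm (f x))\<^sup>2" for x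
        using Basis_le_norm[OF i, of "f x"] by (subst abs_le_square_iff[symmetric]) auto
      then show "AE x in lborel. norm ((f x \<bullet> i)\<^sup>2) \<le> norm ((norm (f x))\<^sup>2)" by simp
    qed measurable
    have gi: "integrable lborel (\<lambda>x. (g x \<bullet> i)\<^sup>2)" "integrable lborel (\<lambda>x. (g' x \<bullet> i)\<^sup>2)"
      using c2 g g' by auto
    have "integrable lborel (\<lambda>x. (g x \<bullet> i)\<^sup>2 + (g' x \<bullet> i)\<^sup>2 - 2 * ((g x \<bullet> i) * (g' x \<bullet> i)))"
      by (intro Bochner_Integration.integrable_diff Bochner_Integration.integrable_add integrable_mult_right integrable_mult_L2 gi) auto
    then have v2: "integrable lborel (\<lambda>x. (v x)\<^sup>2)"
      by (simp add: v_def inner_diff_left power2_diff algebra_simps)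
    have "(\<integral>\<^sup>+x. ennreal ((v x)\<^sup>2) \<partial>lborel) \<le> 2 * 0"
    proof (rule nn_integral_square_le_of_mollified[OF _ v2])
      fix K :: "'a \<Rightarrow> real" and G assume K: "C1_kernel K G"
      have [measurable]: "K \<in> borel_measurable borel" by (rule C1_kernel_measurable[OF K])
      have "(\<integral>z. K z * v (x + z) \<partial>lborel) = 0" for x
      proof -
        have Kg: "integrable lborel (\<lambda>y. (g y \<bullet> i) * K (y - x))" "integrable lborel (\<lambda>y. (g' y \<bullet> i) * K (y - x))"
          using integrable_lborel_translate[OF C1_kernel_integrable_square[OF K], of "-x"]
          by (auto intro!: integrable_mult_L2 gi)
        have tr: "(\<integral>y. v (y + x) * K (y + x - x) \<partial>lborel) = (\<integral>y. v y * K (y - x) \<partial>lborel)"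
          by (rule integral_lborel_translate) auto
        have "(\<integral>y. (g y \<bullet> i) * K (y - x) \<partial>lborel) = (\<integral>y. (g' y \<bullet> i) * K (y - x) \<partial>lborel)"
        proof -
          have "(\<integral>y. u y * (G (y - x) \<bullet> i) \<partial>lborel) = - (\<integral>y. (f y \<bullet> i) * K (y - x) \<partial>lborel)"
            if "weak_gradient u f" for f
            using that C1_kernel_test_fun[OF K, of x] i unfolding weak_gradient_def by blast
          from this[OF g(3)] this[OF g'(3)] show ?thesis by linarith
        qed
        then have "(\<integral>y. v y * K (y - x) \<partial>lborel) = 0"
          using Kg by (simp add: v_def inner_diff_left left_diff_distrib)
        with tr show ?thesis by (simp add: ac_simps)
      qed
      then show "(\<integral>\<^sup>+x. ennreal ((\<integral>z. K z * v (x + z) \<partial>lborel)\<^sup>2) \<partial>lborel) \<le> 0" by simp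
    qed auto
    then have "(\<integral>\<^sup>+x. ennreal ((v x)\<^sup>2) \<partial>lborel) = 0" by simp
    then have "AE x in lborel. ennreal ((v x)\<^sup>2) = 0"
      by (subst (asm) nn_integral_0_iff_AE) auto
    then show ?thesis by eventually_elim (simp add: v_def)
  qed
  then have "AE x in lborel. \<forall>i\<in>Basis. (g x - g' x) \<bullet> i = 0"
    by (subst AE_finite_all) auto
  then show ?thesis
    by eventually_elim (metis eq_iff_diff_eq_0 euclidean_all_zero_iff)
qed

section \<open>Subcritical Sobolev embedding\<close>

text \<open>Compare \<open>u\<close> with its mean \<open>A\<close> over balls of radius
  \<open>r\<close>. By \<open>Mr\<close> and the bound in L^q,
  \<open>\<bar>A x\<bar> \<le> l / 2\<close>; so where \<open>\<bar>u x\<bar> > l\<close>, at least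
  half of \<open>\<bar>u x\<bar>\<close> is carried by \<open>A x - u x\<close>, whose L2 norm the
  translation estimate controls by \<open>r\<close> times that of the gradient. The constant 8 is 4
  times the 2 of that estimate.\<close>

lemma nn_integral_superlevel_square_le:
  fixes u :: "'a::euclidean_space \<Rightarrow> real"
  assumes um[measurable]: "u \<in> borel_measurable borel" and u2: "integrable lborel (\<lambda>x. (u x)\<^sup>2)"
    and gm: "g \<in> borel_measurable borel" and g2: "integrable lborel (\<lambda>x. (norm (g x))\<^sup>2)"
    and wg: "weak_gradient u g"
    and uq: "(\<integral>\<^sup>+x. ennreal (\<bar>u x\<bar> powr q) \<partial>lborel) \<le> ennreal M" and M: "0 \<le> M"
    and q: "1 \<le> q" and l: "0 < l" and r: "0 < r"
    and Mr: "M * (l / 4) powr (1 - q) \<le> (l / 4) * measure lborel (ball (0::'a) r)"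
  shows "(\<integral>\<^sup>+x. ennreal ((u x)\<^sup>2 * indicator {x. \<bar>u x\<bar> > l} x) \<partial>lborel)
    \<le> ennreal (8 * r\<^sup>2 * (\<integral>x. (norm (g x))\<^sup>2 \<partial>lborel))"
proof -
  define c where "c = measure lborel (ball (0::'a) r)"
  have c0: "c > 0" using r by (simp add: c_def)
  have em: "emeasure lborel (ball (0::'a) r) = ennreal c"
    using emeasure_lborel_ball_finite[of "0::'a" r] by (simp add: c_def emeasure_eq_ennreal_measure less_top[symmetric])
  define K where "K z = indicator (ball 0 r) z / c" for z :: 'a
  have [measurable]: "K \<in> borel_measurable borel"
    unfolding K_def by (intro borel_measurable_divide borel_measurable_indicator) auto
  have indi: "integrable lborel (indicator (ball (0::'a) r) :: 'a \<Rightarrow> real)"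
    using em by (intro integrable_real_indicator) auto
  have Ki: "integrable lborel K" unfolding K_def using indi by auto
  have K0: "0 \<le> K z" for z using c0 by (simp add: K_def)
  have K1: "(\<integral>z. K z \<partial>lborel) = 1" using c0 by (simp add: K_def c_def)
  have K2: "integrable lborel (\<lambda>z. (K z)\<^sup>2)"
  proof -
    have "(K z)\<^sup>2 = (1 / c) * K z" for z by (auto simp: K_def indicator_def power2_eq_square)
    then show ?thesis using Ki by simp
  qed
  have Ku: "integrable lborel (\<lambda>z. K z * u (x + z))" for x
    using integrable_lborel_translate[OF u2, of x]
    by (intro integrable_mult_L2 K2) (auto simp: add.commute)
  define A where "A x = (\<integral>z. K z * u (x + z) \<partial>lborel)" for x
  have [measurable]: "A \<in> borel_measurable borel" unfolding A_def by measurable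
  have uqi: "integrable lborel (\<lambda>x. \<bar>u x\<bar> powr q)"
    using uq by (intro integrableI_nonneg) (auto intro: le_less_trans)
  have uqM: "(\<integral>x. \<bar>u x\<bar> powr q \<partial>lborel) \<le> M"
    using uq M uqi by (subst (asm) nn_integral_eq_integral) auto
  \<comment> \<open>Above \<open>l / 4\<close>, write \<open>\<bar>t\<bar>\<close> as a product of
    powers with exponents 1 - q and q; the first factor decreases since q is at least 1.\<close>
  have pt: "\<bar>t\<bar> \<le> l / 4 + (l / 4) powr (1 - q) * \<bar>t\<bar> powr q" for t
  proof (cases "\<bar>t\<bar> \<le> l / 4")
    case True
    then show ?thesis using l by (simp add: add_increasing2)
  next
    case False
    then have t: "l / 4 < \<bar>t\<bar>" by simp
    have "\<bar>t\<bar> = \<bar>t\<bar> powr (1 - q) * \<bar>t\<bar> powr q" using t l by (simp flip: powr_add)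
    also have "\<dots> \<le> (l / 4) powr (1 - q) * \<bar>t\<bar> powr q"
      using t l q by (intro mult_right_mono powr_mono2') auto
    finally show ?thesis using l by linarith
  qed
  have A_le: "\<bar>A x\<bar> \<le> l / 2" for x
  proof -
    have uqx: "integrable lborel (\<lambda>z. \<bar>u (x + z)\<bar> powr q)"
      using integrable_lborel_translate[OF uqi, of x] by (simp add: add.commute)
    have "\<bar>A x\<bar> \<le> (\<integral>z. \<bar>K z * u (x + z)\<bar> \<partial>lborel)"
      unfolding A_def by (rule integral_abs_bound)
    also have "\<dots> \<le> (\<integral>z. (l / 4) * K z + (l / 4) powr (1 - q) / c * \<bar>u (x + z)\<bar> powr q \<partial>lborel)"
    proof (rule integral_mono)
      show "integrable lborel (\<lambda>z. \<bar>K z * u (x + z)\<bar>)" using Ku by auto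
      show "integrable lborel (\<lambda>z. (l / 4) * K z + (l / 4) powr (1 - q) / c * \<bar>u (x + z)\<bar> powr q)"
        using Ki uqx by auto
      fix z
      have "\<bar>K z * u (x + z)\<bar> \<le> K z * (l / 4 + (l / 4) powr (1 - q) * \<bar>u (x + z)\<bar> powr q)"
        using K0[of z] pt[of "u (x + z)"] by (simp add: abs_mult mult_left_mono)
      also have "\<dots> = (l / 4) * K z + K z * ((l / 4) powr (1 - q) * \<bar>u (x + z)\<bar> powr q)"
        by (simp add: algebra_simps)
      also have "\<dots> \<le> (l / 4) * K z + (1 / c) * ((l / 4) powr (1 - q) * \<bar>u (x + z)\<bar> powr q)"
        using c0 by (intro add_left_mono mult_right_mono) (auto simp: K_def indicator_def)
      finally show "\<bar>K z * u (x + z)\<bar> \<le> (l / 4) * K z + (l / 4) powr (1 - q) / c * \<bar>u (x + z)\<bar> powr q"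
        by simp
    qed
    also have "\<dots> = l / 4 + (l / 4) powr (1 - q) / c * (\<integral>z. \<bar>u (x + z)\<bar> powr q \<partial>lborel)"
      using Ki uqx K1 by simp
    also have "(\<integral>z. \<bar>u (x + z)\<bar> powr q \<partial>lborel) = (\<integral>z. \<bar>u z\<bar> powr q \<partial>lborel)"
      using integral_lborel_translate[of "\<lambda>z. \<bar>u z\<bar> powr q" x] by (simp add: add.commute)
    also have "l / 4 + (l / 4) powr (1 - q) / c * (\<integral>z. \<bar>u z\<bar> powr q \<partial>lborel) \<le> l / 4 + (l / 4) powr (1 - q) / c * M"
      using uqM c0 by (intro add_left_mono mult_left_mono) auto
    also have "\<dots> \<le> l / 4 + l / 4"
      using Mr c0 by (simp add: c_def field_simps)
    finally show ?thesis by simp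
  qed
  have "(\<integral>\<^sup>+x. ennreal ((A x - u x)\<^sup>2) \<partial>lborel)
      = (\<integral>\<^sup>+x. ennreal ((\<integral>z. K z * (u (x + z) - u x) \<partial>lborel)\<^sup>2) \<partial>lborel)"
  proof (rule nn_integral_cong)
    fix x
    have "(\<integral>z. K z * (u (x + z) - u x) \<partial>lborel) = (\<integral>z. K z * u (x + z) - K z * u x \<partial>lborel)"
      by (simp add: algebra_simps)
    also have "\<dots> = A x - u x"
      using Ku[of x] Ki K1 by (simp add: A_def)
    finally show "ennreal ((A x - u x)\<^sup>2) = ennreal ((\<integral>z. K z * (u (x + z) - u x) \<partial>lborel)\<^sup>2)" by simp
  qed
  also have "\<dots> \<le> ennreal (2 * r\<^sup>2 * (\<integral>x. (norm (g x))\<^sup>2 \<partial>lborel))"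
  proof (rule nn_integral_weighted_mean_square_le[OF Ki K0 K1])
    fix z assume "K z \<noteq> 0"
    then have z: "norm z \<le> r" by (auto simp: K_def indicator_def split: if_splits)
    have "(\<integral>\<^sup>+x. ennreal ((u (x + z) - u x)\<^sup>2) \<partial>lborel) \<le> ennreal (2 * (norm z)\<^sup>2 * (\<integral>x. (norm (g x))\<^sup>2 \<partial>lborel))"
      by (rule nn_integral_translation_difference_le[OF um u2 gm g2 wg])
    also have "\<dots> \<le> ennreal (2 * r\<^sup>2 * (\<integral>x. (norm (g x))\<^sup>2 \<partial>lborel))"
      using z by (intro ennreal_leI mult_right_mono mult_left_mono power_mono) auto
    finally show "(\<integral>\<^sup>+x. ennreal ((u (x + z) - u x)\<^sup>2) \<partial>lborel) \<le> ennreal (2 * r\<^sup>2 * (\<integral>x. (norm (g x))\<^sup>2 \<partial>lborel))" .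
  qed auto
  finally have Au: "(\<integral>\<^sup>+x. ennreal ((A x - u x)\<^sup>2) \<partial>lborel) \<le> ennreal (2 * r\<^sup>2 * (\<integral>x. (norm (g x))\<^sup>2 \<partial>lborel))" .
  have "(\<integral>\<^sup>+x. ennreal ((u x)\<^sup>2 * indicator {x. \<bar>u x\<bar> > l} x) \<partial>lborel) \<le> (\<integral>\<^sup>+x. 4 * ennreal ((A x - u x)\<^sup>2) \<partial>lborel)"
  proof (rule nn_integral_mono)
    fix x
    have "(u x)\<^sup>2 * indicator {x. \<bar>u x\<bar> > l} x \<le> 4 * (A x - u x)\<^sup>2"
    proof (cases "\<bar>u x\<bar> > l")
      case True
      then have "\<bar>u x\<bar> \<le> \<bar>2 * (A x - u x)\<bar>" using A_le[of x] by (auto simp: abs_if split: if_splits)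
      then have "(u x)\<^sup>2 \<le> (2 * (A x - u x))\<^sup>2" by (subst abs_le_square_iff[symmetric])
      then have "(u x)\<^sup>2 \<le> 4 * (A x - u x)\<^sup>2" unfolding power_mult_distrib by simp
      then show ?thesis using True by simp
    qed simp
    then have "ennreal ((u x)\<^sup>2 * indicator {x. \<bar>u x\<bar> > l} x) \<le> ennreal (4 * (A x - u x)\<^sup>2)" by (rule ennreal_leI)
    then show "ennreal ((u x)\<^sup>2 * indicator {x. \<bar>u x\<bar> > l} x) \<le> 4 * ennreal ((A x - u x)\<^sup>2)"
      by (simp add: ennreal_mult')
  qed
  also have "\<dots> = 4 * (\<integral>\<^sup>+x. ennreal ((A x - u x)\<^sup>2) \<partial>lborel)"
    by (rule nn_integral_cmult) auto
  also have "\<dots> \<le> 4 * ennreal (2 * r\<^sup>2 * (\<integral>x. (norm (g x))\<^sup>2 \<partial>lborel))"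
    by (intro mult_left_mono Au) auto
  also have "\<dots> = ennreal (8 * r\<^sup>2 * (\<integral>x. (norm (g x))\<^sup>2 \<partial>lborel))"
    by (simp flip: ennreal_mult' ennreal_numeral)
  finally show ?thesis .
qed

definition H1_ball :: "real \<Rightarrow> ('a::euclidean_space \<Rightarrow> real) \<Rightarrow> bool" where
  "H1_ball B u \<longleftrightarrow> u \<in> borel_measurable borel \<and> integrable lborel (\<lambda>x. (u x)\<^sup>2)
     \<and> (\<exists>g. g \<in> borel_measurable borel \<and> integrable lborel (\<lambda>x. (norm (g x))\<^sup>2) \<and> weak_gradient u g
          \<and> (\<integral>x. (u x)\<^sup>2 \<partial>lborel) + (\<integral>x. (norm (g x))\<^sup>2 \<partial>lborel) \<le> B)"

lemma H1_ball_L2_le: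
  fixes u :: "'a::euclidean_space \<Rightarrow> real"
  assumes "H1_ball B u"
  shows "(\<integral>x. (u x)\<^sup>2 \<partial>lborel) \<le> B"
proof -
  obtain g :: "'a \<Rightarrow> 'a" where g: "g \<in> borel_measurable borel" "integrable lborel (\<lambda>x. (norm (g x))\<^sup>2)" "weak_gradient u g"
      "(\<integral>x. (u x)\<^sup>2 \<partial>lborel) + (\<integral>x. (norm (g x))\<^sup>2 \<partial>lborel) \<le> B"
    using assms unfolding H1_ball_def by blast
  have "0 \<le> (\<integral>x. (norm (g x))\<^sup>2 \<partial>lborel)" by (intro integral_nonneg_AE) auto
  then show ?thesis using g(4) by linarith
qed

text \<open>The averaging radius is adapted to the level: the ball must be large enough for the L^q
  bound to push the mean below \<open>l / 2\<close>, which means a radius proportional to l^(-q/N).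
  Its square is the decay rate.\<close>

lemma H1_ball_superlevel_decay:
  assumes Lq: "\<And>u::'a::euclidean_space \<Rightarrow> real. H1_ball B u \<Longrightarrow> (\<integral>\<^sup>+x. ennreal (\<bar>u x\<bar> powr q) \<partial>lborel) \<le> ennreal M"
    and q: "1 \<le> q" and B: "0 \<le> B"
  obtains C where "0 \<le> C"
    "\<And>(u::'a \<Rightarrow> real) l. H1_ball B u \<Longrightarrow> 0 < l \<Longrightarrow>
       (\<integral>\<^sup>+x. ennreal ((u x)\<^sup>2 * indicator {x. \<bar>u x\<bar> > l} x) \<partial>lborel)
         \<le> ennreal (C * l powr (- 2 * q / DIM('a)))"
proof -
  define N where "N = real DIM('a)"
  have N: "N > 0" by (simp add: N_def)
  define M' where "M' = max M 1"
  define \<omega> where "\<omega> = unit_ball_vol N"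
  have \<omega>: "\<omega> > 0" using N by (simp add: \<omega>_def)
  define b where "b = (M' / \<omega>) powr (1 / N)"
  have b: "b > 0" using \<omega> by (simp add: b_def M'_def)
  define C where "C = 8 * b\<^sup>2 * (1 / 4) powr (- 2 * q / N) * B"
  show ?thesis
  proof (rule that[of C])
    show "0 \<le> C" using B by (simp add: C_def)
    fix u :: "'a \<Rightarrow> real" and l :: real
    assume u: "H1_ball B u" and l: "0 < l"
    obtain g where g: "g \<in> borel_measurable borel" "integrable lborel (\<lambda>x. (norm (g x))\<^sup>2)" "weak_gradient u g"
      "(\<integral>x. (u x)\<^sup>2 \<partial>lborel) + (\<integral>x. (norm (g x))\<^sup>2 \<partial>lborel) \<le> B"
      using u unfolding H1_ball_def by blast
    have u': "u \<in> borel_measurable borel" "integrable lborel (\<lambda>x. (u x)\<^sup>2)"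
      using u unfolding H1_ball_def by auto
    have "0 \<le> (\<integral>x. (u x)\<^sup>2 \<partial>lborel)" by (intro integral_nonneg_AE) auto
    then have gB: "(\<integral>x. (norm (g x))\<^sup>2 \<partial>lborel) \<le> B" using g(4) by linarith
    \<comment> \<open>This radius turns the volume condition of the superlevel estimate into an
      equality.\<close>
    define r where "r = b * (l / 4) powr (- q / N)"
    have r: "0 < r" using b l by (simp add: r_def)
    have rN: "r ^ DIM('a) = M' / \<omega> * (l / 4) powr (- q)"
    proof -
      have "r ^ DIM('a) = r powr N" using r by (simp add: N_def powr_realpow)
      also have "\<dots> = b powr N * ((l / 4) powr (- q / N)) powr N" using b l by (simp add: r_def powr_mult)
      also have "b powr N = M' / \<omega>" using N \<omega> by (simp add: b_def powr_powr M'_def)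
      also have "((l / 4) powr (- q / N)) powr N = (l / 4) powr (- q)" using N by (simp add: powr_powr)
      finally show ?thesis .
    qed
    have "M' * (l / 4) powr (1 - q) = (l / 4) * (\<omega> * r ^ DIM('a))"
      using l \<omega> by (simp add: rN powr_diff powr_minus field_simps)
    then have Mr: "M' * (l / 4) powr (1 - q) \<le> (l / 4) * measure lborel (ball (0::'a) r)"
      using r by (simp add: content_ball \<omega>_def N_def)
    have uq: "(\<integral>\<^sup>+x. ennreal (\<bar>u x\<bar> powr q) \<partial>lborel) \<le> ennreal M'"
      using Lq[OF u] by (rule order_trans) (auto intro!: ennreal_leI simp: M'_def)
    have "(\<integral>\<^sup>+x. ennreal ((u x)\<^sup>2 * indicator {x. \<bar>u x\<bar> > l} x) \<partial>lborel)
      \<le> ennreal (8 * r\<^sup>2 * (\<integral>x. (norm (g x))\<^sup>2 \<partial>lborel))"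
      by (rule nn_integral_superlevel_square_le[OF u' g(1-3) uq _ q l r Mr]) (simp add: M'_def)
    also have "\<dots> \<le> ennreal (8 * r\<^sup>2 * B)"
      using gB by (intro ennreal_leI mult_left_mono) auto
    also have "8 * r\<^sup>2 * B = C * l powr (- 2 * q / N)"
    proof -
      have "r\<^sup>2 = b\<^sup>2 * ((l / 4) powr (- q / N))\<^sup>2" by (simp add: r_def power_mult_distrib)
      also have "((l / 4) powr (- q / N))\<^sup>2 = (l / 4) powr (- 2 * q / N)"
        using l by (simp add: power2_eq_square flip: powr_add)
      also have "\<dots> = l powr (- 2 * q / N) * (1 / 4) powr (- 2 * q / N)"
        using l powr_mult[of l "1/4" "- 2 * q / N"] by simp
      finally show ?thesis by (simp add: C_def)
    qed
    finally show "(\<integral>\<^sup>+x. ennreal ((u x)\<^sup>2 * indicator {x. \<bar>u x\<bar> > l} x) \<partial>lborel)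
         \<le> ennreal (C * l powr (- 2 * q / DIM('a)))" by (simp add: N_def)
  qed
qed

text \<open>Dyadic decomposition in the values of \<open>u\<close>: on the layer from 2^k to 2^(k+1)
  the power s costs a factor 2^((k+1)(s-2)) over the square, and the superlevel decay beats it.
  Values up to 1 are handled by the L2 norm.\<close>

lemma H1_ball_Lq_improve:
  assumes Lq: "\<And>u::'a::euclidean_space \<Rightarrow> real. H1_ball B u \<Longrightarrow> (\<integral>\<^sup>+x. ennreal (\<bar>u x\<bar> powr q) \<partial>lborel) \<le> ennreal M"
    and q: "1 \<le> q" and B: "0 \<le> B" and s: "2 \<le> s" "s < 2 + 2 * q / DIM('a)"
  obtains M' where "\<And>u::'a \<Rightarrow> real. H1_ball B u \<Longrightarrow> (\<integral>\<^sup>+x. ennreal (\<bar>u x\<bar> powr s) \<partial>lborel) \<le> ennreal M'"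
proof -
  obtain C where C: "0 \<le> C" "\<And>(u::'a \<Rightarrow> real) l. H1_ball B u \<Longrightarrow> 0 < l \<Longrightarrow>
       (\<integral>\<^sup>+x. ennreal ((u x)\<^sup>2 * indicator {x. \<bar>u x\<bar> > l} x) \<partial>lborel)
         \<le> ennreal (C * l powr (- 2 * q / DIM('a)))"
    using H1_ball_superlevel_decay[OF Lq q B] by blast
  \<comment> \<open>The ratio of successive layer bounds; it is below 1 exactly because s < 2 +
    2q/N.\<close>
  define \<rho> where "\<rho> = 2 powr (s - 2 - 2 * q / DIM('a))"
  have \<rho>: "0 \<le> \<rho>" "\<rho> < 1" using s powr_less_mono[of "s - 2 - 2 * q / DIM('a)" 0 2] by (auto simp: \<rho>_def)
  define a where "a k = C * 2 powr (s - 2) * \<rho> ^ k" for k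
  have a0: "0 \<le> a k" for k using C(1) \<rho> by (simp add: a_def)
  have as: "summable a" unfolding a_def using \<rho> by (intro summable_mult summable_geometric) auto
  show ?thesis
  proof (rule that[of "B + suminf a"])
    fix u :: "'a \<Rightarrow> real" assume u: "H1_ball B u"
    have [measurable]: "u \<in> borel_measurable borel" and u2: "integrable lborel (\<lambda>x. (u x)\<^sup>2)"
      using u unfolding H1_ball_def by auto
    have uB: "(\<integral>x. (u x)\<^sup>2 \<partial>lborel) \<le> B" by (rule H1_ball_L2_le[OF u])
    define t where "t k x = 2 powr ((real k + 1) * (s - 2)) * ((u x)\<^sup>2 * indicator {x. \<bar>u x\<bar> > 2 ^ k} x)" for k x
    have tm[measurable]: "t k \<in> borel_measurable borel" for k unfolding t_def by measurable
    have pt: "ennreal (\<bar>u x\<bar> powr s) \<le> ennreal ((u x)\<^sup>2) + (\<Sum>k. ennreal (t k x))" for x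
    proof (cases "\<bar>u x\<bar> \<le> 1")
      case True
      have "\<bar>u x\<bar> powr s \<le> \<bar>u x\<bar> powr 2"
      proof (cases "u x = 0")
        case False
        then show ?thesis using powr_mono'[of 2 s "\<bar>u x\<bar>"] True s by simp
      qed (use s in simp)
      also have "\<dots> = (u x)\<^sup>2" by (cases "u x = 0") (simp_all add: powr_numeral)
      finally have "ennreal (\<bar>u x\<bar> powr s) \<le> ennreal ((u x)\<^sup>2)" by (rule ennreal_leI)
      then show ?thesis by (rule order_trans) simp
    next
      case False
      obtain m :: nat where m: "\<bar>u x\<bar> < 2 ^ m" using real_arch_pow[of 2 "\<bar>u x\<bar>"] by auto
      \<comment> \<open>Minimality of \<open>n\<close> locates the layer. As
        \<open>\<bar>u x\<bar> > 1\<close>, n is not 0, and its predecessor \<open>k\<close>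
        satisfies \<open>2 ^ k < \<bar>u x\<bar>\<close>.\<close>
      define n where "n = (LEAST n::nat. \<bar>u x\<bar> \<le> 2 ^ n)"
      have n: "\<bar>u x\<bar> \<le> 2 ^ n" 
        unfolding n_def by (rule LeastI[of "\<lambda>n. \<bar>u x\<bar> \<le> 2 ^ n" m]) (use m in simp)
      with False have "n \<noteq> 0" by (intro notI) simp
      then obtain k where k: "n = Suc k" by (cases n) auto
      have "\<not> \<bar>u x\<bar> \<le> 2 ^ k" using not_less_Least[of k "\<lambda>n. \<bar>u x\<bar> \<le> 2 ^ n"] k unfolding n_def by auto
      then have uk: "2 ^ k < \<bar>u x\<bar>" by simp
      have u0: "u x \<noteq> 0" using False by auto
      have "\<bar>u x\<bar> powr s = \<bar>u x\<bar> powr (s - 2) * \<bar>u x\<bar> powr 2"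
        unfolding powr_add[symmetric] by simp
      also have "\<bar>u x\<bar> powr 2 = (u x)\<^sup>2" using u0 by (simp add: powr_numeral)
      also have "\<bar>u x\<bar> powr (s - 2) * (u x)\<^sup>2 \<le> (2 ^ n) powr (s - 2) * (u x)\<^sup>2"
        using n s by (intro mult_right_mono powr_mono2) auto
      also have "(2 ^ n) powr (s - 2) = (2::real) powr (real n * (s - 2))"
        by (simp add: powr_powr flip: powr_realpow)
      also have "real n = real k + 1" using k by simp
      finally have "\<bar>u x\<bar> powr s \<le> t k x" using uk by (simp add: t_def)
      then have "ennreal (\<bar>u x\<bar> powr s) \<le> (\<Sum>i\<in>{k}. ennreal (t i x))" by (simp add: ennreal_leI)
      also have "\<dots> \<le> (\<Sum>k. ennreal (t k x))" by (rule sum_le_suminf) auto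
      finally show ?thesis by (rule order_trans) simp
    qed
    have tk: "(\<integral>\<^sup>+x. ennreal (t k x) \<partial>lborel) \<le> ennreal (a k)" for k
    proof -
      have "(\<integral>\<^sup>+x. ennreal (t k x) \<partial>lborel)
        = ennreal (2 powr ((real k + 1) * (s - 2))) * (\<integral>\<^sup>+x. ennreal ((u x)\<^sup>2 * indicator {x. \<bar>u x\<bar> > 2 ^ k} x) \<partial>lborel)"
        unfolding t_def by (subst nn_integral_cmult[symmetric]) (auto simp: ennreal_mult')
      also have "\<dots> \<le> ennreal (2 powr ((real k + 1) * (s - 2))) * ennreal (C * (2 ^ k) powr (- 2 * q / DIM('a)))"
        by (intro mult_left_mono C(2)[OF u]) auto
      also have "\<dots> = ennreal (2 powr ((real k + 1) * (s - 2)) * (C * (2 ^ k) powr (- 2 * q / DIM('a))))"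
        by (simp add: ennreal_mult')
      also have "2 powr ((real k + 1) * (s - 2)) * (C * (2 ^ k) powr (- 2 * q / DIM('a))) = a k"
      proof -
        have "(2 ^ k) powr (- 2 * q / DIM('a)) = (2::real) powr (real k * (- 2 * q / DIM('a)))"
          by (simp add: powr_powr flip: powr_realpow)
        moreover have "\<rho> ^ k = 2 powr ((s - 2 - 2 * q / DIM('a)) * real k)"
          unfolding \<rho>_def by (simp add: powr_powr flip: powr_realpow)
        moreover have "(real k + 1) * (s - 2) + real k * (- 2 * q / DIM('a)) = (s - 2) + (s - 2 - 2 * q / DIM('a)) * real k"
          by (simp add: algebra_simps)
        ultimately show ?thesis
          unfolding a_def by (simp add: mult.left_commute mult.assoc flip: powr_add)
      qed
      finally show ?thesis .
    qed
    have "(\<integral>\<^sup>+x. ennreal (\<bar>u x\<bar> powr s) \<partial>lborel) \<le> (\<integral>\<^sup>+x. ennreal ((u x)\<^sup>2) + (\<Sum>k. ennreal (t k x)) \<partial>lborel)"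
      by (intro nn_integral_mono pt)
    also have "\<dots> = (\<integral>\<^sup>+x. ennreal ((u x)\<^sup>2) \<partial>lborel) + (\<Sum>k. (\<integral>\<^sup>+x. ennreal (t k x) \<partial>lborel))"
      by (subst nn_integral_add) (auto simp: nn_integral_suminf)
    also have "\<dots> \<le> ennreal B + (\<Sum>k. ennreal (a k))"
    proof (rule add_mono)
      show "(\<integral>\<^sup>+x. ennreal ((u x)\<^sup>2) \<partial>lborel) \<le> ennreal B"
        using u2 uB by (subst nn_integral_eq_integral) (auto intro: ennreal_leI)
      show "(\<Sum>k. (\<integral>\<^sup>+x. ennreal (t k x) \<partial>lborel)) \<le> (\<Sum>k. ennreal (a k))"
        by (intro suminf_le tk) auto
    qed
    also have "(\<Sum>k. ennreal (a k)) = ennreal (suminf a)"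
      using a0 as by (rule suminf_ennreal2)
    also have "ennreal B + ennreal (suminf a) = ennreal (B + suminf a)"
      using B a0 as by (intro ennreal_plus[symmetric] suminf_nonneg) auto
    finally show "(\<integral>\<^sup>+x. ennreal (\<bar>u x\<bar> powr s) \<partial>lborel) \<le> ennreal (B + suminf a)" .
  qed
qed

text \<open>The exponent \<open>2N/(N - 2)\<close> is the fixed point of \<open>q \<mapsto> 2 + 2q/N\<close>.\<close>

theorem H1_ball_Lq_bounded:
  assumes q: "2 \<le> q" "(real DIM('a) - 2) * q < 2 * real DIM('a)" and B: "0 \<le> B"
  obtains M where "\<And>u::'a::euclidean_space \<Rightarrow> real. H1_ball B u \<Longrightarrow> (\<integral>\<^sup>+x. ennreal (\<bar>u x\<bar> powr q) \<partial>lborel) \<le> ennreal M"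
proof -
  define N where "N = real DIM('a)"
  have N: "N > 0" by (simp add: N_def)
  define S where "S = {s. 2 \<le> s \<and> (\<exists>M. \<forall>u::'a \<Rightarrow> real. H1_ball B u \<longrightarrow> (\<integral>\<^sup>+x. ennreal (\<bar>u x\<bar> powr s) \<partial>lborel) \<le> ennreal M)}"
  have "2 \<in> S"
  proof -
    have "(\<integral>\<^sup>+x. ennreal (\<bar>u x\<bar> powr 2) \<partial>lborel) \<le> ennreal B" if u: "H1_ball B u" for u :: "'a \<Rightarrow> real"
    proof -
      have uB: "(\<integral>x. (u x)\<^sup>2 \<partial>lborel) \<le> B" by (rule H1_ball_L2_le[OF u])
      have "\<bar>u x\<bar> powr 2 = (u x)\<^sup>2" for x by (cases "u x = 0") (simp_all add: powr_numeral)
      then show ?thesis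
        using u uB by (simp add: H1_ball_def nn_integral_eq_integral ennreal_leI)
    qed
    then show ?thesis unfolding S_def by auto
  qed
  have improve: "t \<in> S" if s: "s \<in> S" and t: "2 \<le> t" "t < 2 + 2 * s / N" for s t
  proof -
    obtain M where M: "\<And>u::'a \<Rightarrow> real. H1_ball B u \<Longrightarrow> (\<integral>\<^sup>+x. ennreal (\<bar>u x\<bar> powr s) \<partial>lborel) \<le> ennreal M"
      using s unfolding S_def by blast
    have "1 \<le> s" using s by (simp add: S_def)
    from H1_ball_Lq_improve[OF M this B t(1)] t(2) show ?thesis
      using t(1) unfolding S_def N_def by blast
  qed
  have "q \<in> S"
  proof (rule ccontr)
    assume nq: "q \<notin> S"
    \<comment> \<open>Suppose \<open>q\<close> is not reached. The supremum of the exponents reached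
      below \<open>q\<close> will be overstepped by one more improvement.\<close>
    define T where "T = S \<inter> {2..q}"
    have T: "2 \<in> T" using \<open>2 \<in> S\<close> q by (simp add: T_def)
    have bdd: "bdd_above T" by (auto simp: T_def bdd_above_def)
    define \<sigma> where "\<sigma> = Sup T"
    have \<sigma>: "2 \<le> \<sigma>" "\<sigma> \<le> q"
      using T bdd by (auto simp: \<sigma>_def T_def intro!: cSup_upper cSup_least)
    have "(N - 2) * \<sigma> < 2 * N"
    proof (cases "N \<ge> 2")
      case True
      then have "(N - 2) * \<sigma> \<le> (N - 2) * q" using \<sigma> by (intro mult_left_mono) auto
      then show ?thesis using q by (simp add: N_def)
    next
      case False
      then have "(N - 2) * \<sigma> \<le> 0" using \<sigma> by (intro mult_nonpos_nonneg) auto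
      then show ?thesis using N by linarith
    qed
    \<comment> \<open>This says \<sigma> < 2 + 2\<sigma>/N. The inequality is strict, so it survives
      replacing \<sigma> on the right by a nearby reached exponent \<open>s\<close>; the supremum
      itself need not be reached.\<close>
    then have "N * (\<sigma> - 2) / 2 < \<sigma>" by (simp add: algebra_simps)
    then obtain s where s: "s \<in> T" "N * (\<sigma> - 2) / 2 < s"
      unfolding \<sigma>_def using T bdd by (subst (asm) less_cSup_iff) auto
    have s\<sigma>: "\<sigma> < 2 + 2 * s / N" using s(2) N by (simp add: field_simps)
    have sS: "s \<in> S" using s by (simp add: T_def)
    have "2 + 2 * s / N \<le> q"
      using improve[OF sS q(1)] nq by (meson not_less)
    \<comment> \<open>The midpoint lies strictly above \<sigma>, within reach from \<open>s\<close>,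
      and not above \<open>q\<close>.\<close>
    define t where "t = (\<sigma> + (2 + 2 * s / N)) / 2"
    have "t \<in> S" using improve[OF sS, of t] \<sigma> s\<sigma> by (simp add: t_def)
    then have "t \<in> T" using \<sigma> s\<sigma> \<open>2 + 2 * s / N \<le> q\<close> by (simp add: T_def t_def)
    then have "t \<le> \<sigma>" using bdd by (simp add: \<sigma>_def cSup_upper)
    then show False using s\<sigma> by (simp add: t_def)
  qed
  then show ?thesis using that unfolding S_def by blast
qed

section \<open>The nonlinearity\<close>

text \<open>F1 to F4 with the constants of the growth bound fixed. The upper bound on
  \<open>p\<close> involves the dimension and is imposed in a later context.\<close>

locale superquadratic =
  fixes f :: "real \<Rightarrow> real" and C p :: real
  assumes f_cont: "continuous_on UNIV f"
    and p_gt_2: "2 < p"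
    and f_growth: "\<And>s. \<bar>f s\<bar> \<le> C * (1 + \<bar>s\<bar> powr (p - 1))"
    and f_small: "((\<lambda>s. f s / s) \<longlongrightarrow> 0) (at 0)"
    and Prim_superquadratic: "filterlim (\<lambda>s. Prim f s / s\<^sup>2) at_top at_infinity"
    and f_mono: "strict_mono_on {..<0} (\<lambda>s. f s / \<bar>s\<bar>)" "strict_mono_on {0<..} (\<lambda>s. f s / \<bar>s\<bar>)"
begin

lemma f_0: "f 0 = 0"
proof -
  have "((\<lambda>s. f s / s * s) \<longlongrightarrow> 0 * 0) (at 0)"
    by (intro tendsto_mult f_small) auto
  moreover have "\<forall>\<^sub>F s in at 0. f s / s * s = f s"
    by (auto simp: eventually_at intro!: exI[of _ 1])
  ultimately have "(f \<longlongrightarrow> 0 * 0) (at 0)"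
    by (rule Lim_transform_eventually)
  moreover have "(f \<longlongrightarrow> f 0) (at 0)"
    using f_cont by (simp add: continuous_on_eq_continuous_at isCont_def)
  ultimately show ?thesis using LIM_unique by force
qed

text \<open>The quotient \<open>f s / s\<close> is 0 at \<open>s = 0\<close> by the convention on division, which is
  also its limit there.\<close>

lemma quotient_continuous: "continuous_on UNIV (\<lambda>s. f s / s)"
  unfolding continuous_on_eq_continuous_at[OF open_UNIV]
proof
  fix s :: real
  have "isCont f s" using f_cont by (simp add: continuous_on_eq_continuous_at)
  then show "isCont (\<lambda>s. f s / s) s"
    using f_small by (cases "s = 0") (auto simp: isCont_def intro!: tendsto_intros)
qed

lemma f_measurable [measurable]: "f \<in> borel_measurable borel"
  using f_cont by (rule borel_measurable_continuous_onI)

section \<open>Monotonicity of the quotient in the distance from 0\<close>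

lemma quotient_strict_mono_pos: "0 < a \<Longrightarrow> a < b \<Longrightarrow> f a / a < f b / b"
  using f_mono(2) by (auto simp: strict_mono_on_def)

lemma quotient_strict_antimono_neg: "b < a \<Longrightarrow> a < 0 \<Longrightarrow> f a / a < f b / b"
  using strict_mono_onD[OF f_mono(1), of b a] by auto

text \<open>Moving towards 0 decreases the quotient, so its limit 0 at the origin bounds it from
  below.\<close>

lemma quotient_nonneg: "0 \<le> f s / s"
proof -
  consider "s = 0" | "0 < s" | "s < 0" by linarith
  then show ?thesis
  proof cases
    case 2
    have "((\<lambda>s. f s / s) \<longlongrightarrow> 0) (at_right 0)"
      using f_small by (rule filterlim_mono) (auto simp: at_le)
    moreover have "\<forall>\<^sub>F z in at_right 0. f z / z \<le> f s / s"
      using 2 quotient_strict_mono_pos by (auto simp: eventually_at_right intro!: exI[of _ s] less_imp_le)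
    ultimately show ?thesis by (rule tendsto_upperbound) auto
  next
    case 3
    have "((\<lambda>s. f s / s) \<longlongrightarrow> 0) (at_left 0)"
      using f_small by (rule filterlim_mono) (auto simp: at_le)
    moreover have "\<forall>\<^sub>F z in at_left 0. f z / z \<le> f s / s"
      using 3 quotient_strict_antimono_neg by (auto simp: eventually_at_left intro!: exI[of _ s] less_imp_le)
    ultimately show ?thesis by (rule tendsto_upperbound) auto
  qed auto
qed

text \<open>On the negative axis \<open>f s / \<bar>s\<bar>\<close> is minus the quotient, so F4
  makes the quotient grow with \<open>\<bar>s\<bar>\<close> on both sides. The case
  \<open>a = 0\<close> is nonnegativity, by the convention on division.\<close>

lemma quotient_scale_mono:
  assumes "0 \<le> a" "a \<le> b"
  shows "f (a * s) / (a * s) \<le> f (b * s) / (b * s)"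
proof (cases "a = 0 \<or> s = 0 \<or> a = b")
  case True
  then show ?thesis using quotient_nonneg[of "b * s"] by auto
next
  case False
  then have ab: "0 < a" "a < b" "s \<noteq> 0" using assms by auto
  show ?thesis
  proof (cases "s > 0")
    case True
    then show ?thesis using ab by (intro less_imp_le quotient_strict_mono_pos) auto
  next
    case False
    then have "s < 0" using ab by simp
    then show ?thesis using ab by (intro less_imp_le quotient_strict_antimono_neg) (auto simp: mult_pos_neg)
  qed
qed

lemma f_times_eq: "f s * s = f s / s * s\<^sup>2"
  by (simp add: power2_eq_square)

lemma Prim_0 [simp]: "Prim f 0 = 0"
  by (simp add: Prim_def)

section \<open>The primitive along rays\<close>

lemma Prim_has_derivative: "(Prim f has_real_derivative f s) (at s)"
proof -
  have "\<exists>F. \<forall>x::real. - \<infinity> < ereal x \<longrightarrow> ereal x < \<infinity> \<longrightarrow> (F has_vector_derivative f x) (at x)"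
    by (rule einterval_antiderivative) (use f_cont in \<open>auto simp: continuous_on_eq_continuous_at\<close>)
  then obtain F where F: "\<And>x. (F has_vector_derivative f x) (at x)" by auto
  have "Prim f t = F t - F 0" for t
    unfolding Prim_def
    by (rule interval_integral_FTC_finite)
       (auto intro: continuous_on_subset[OF f_cont] has_vector_derivative_at_within[OF F])
  then have "Prim f = (\<lambda>t. F t - F 0)" by auto
  moreover have "((\<lambda>t. F t - F 0) has_real_derivative f s) (at s)"
    using F[of s] by (auto intro!: derivative_eq_intros simp: has_real_derivative_iff_has_vector_derivative)
  ultimately show ?thesis by simp
qed

lemma Prim_continuous: "continuous_on UNIV (Prim f)"
  by (meson DERIV_isCont Prim_has_derivative continuous_at_imp_continuous_on)

lemma Prim_measurable [measurable]: "Prim f \<in> borel_measurable borel"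
  using Prim_continuous by (rule borel_measurable_continuous_onI)

lemma Prim_scale_has_derivative:
  "((\<lambda>t. Prim f (t * s)) has_real_derivative f (t * s) * s) (at t)"
  by (rule DERIV_chain2[OF Prim_has_derivative]) (auto intro!: derivative_eq_intros)

lemma f_scale_times_eq: "f (t * s) * s = t * (s\<^sup>2 * (f (t * s) / (t * s)))"
  by (cases "t = 0 \<or> s = 0") (auto simp: f_0 power2_eq_square)

lemma Prim_nonneg: "0 \<le> Prim f s"
proof -
  have "Prim f (0 * s) \<le> Prim f (1 * s)"
  proof (rule DERIV_nonneg_imp_nondecreasing[of 0 1 "\<lambda>t. Prim f (t * s)"])
    fix t :: real assume "0 \<le> t" "t \<le> 1"
    then have "0 \<le> f (t * s) * s"
      using quotient_nonneg[of "t * s"] unfolding f_scale_times_eq by (intro mult_nonneg_nonneg) auto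
    then show "\<exists>y. ((\<lambda>t. Prim f (t * s)) has_real_derivative y) (at t) \<and> 0 \<le> y"
      using Prim_scale_has_derivative by blast
  qed simp
  then show ?thesis by simp
qed

text \<open>The function \<open>m\<close> in the proof is minimal at \<open>t = 1\<close>: its
  derivative is t times a square times the difference of the quotients at \<open>t * s\<close> and
  \<open>s\<close>, and so changes sign there. Integrated over a Nehari function, the inequality
  states that its energy is maximal on the ray.\<close>

lemma Prim_scale_ge:
  assumes "0 \<le> t"
  shows "Prim f s + (t\<^sup>2 - 1) / 2 * (f s * s) \<le> Prim f (t * s)"
proof -
  define m where "m t = Prim f (t * s) - t\<^sup>2 / 2 * (f s / s * s\<^sup>2)" for t
  have md: "(m has_real_derivative t * (s\<^sup>2 * (f (t * s) / (t * s) - f s / s))) (at t)" for t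
    unfolding m_def
    by (rule DERIV_cong, rule DERIV_diff[OF Prim_scale_has_derivative])
       (auto intro!: derivative_eq_intros simp only: f_scale_times_eq, simp add: algebra_simps)
  have "m 1 \<le> m t"
  proof (cases "t \<le> 1")
    case True
    then show ?thesis
    proof (rule DERIV_nonpos_imp_nonincreasing)
      fix x assume x: "t \<le> x" "x \<le> 1"
      then have "x * (s\<^sup>2 * (f (x * s) / (x * s) - f s / s)) \<le> 0"
        using quotient_scale_mono[of x 1 s] assms by (intro mult_nonneg_nonpos) auto
      then show "\<exists>y. (m has_real_derivative y) (at x) \<and> y \<le> 0" using md by blast
    qed
  next
    case False
    then have "1 \<le> t" by simp
    then show ?thesis
    proof (rule DERIV_nonneg_imp_nondecreasing)
      fix x assume x: "1 \<le> x" "x \<le> t"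
      then have "0 \<le> x * (s\<^sup>2 * (f (x * s) / (x * s) - f s / s))"
        using quotient_scale_mono[of 1 x s] by (intro mult_nonneg_nonneg) auto
      then show "\<exists>y. (m has_real_derivative y) (at x) \<and> 0 \<le> y" using md by blast
    qed
  qed
  then show ?thesis unfolding m_def f_times_eq[symmetric] by (simp add: field_simps)
qed

lemma Prim_le: "Prim f s \<le> f s * s / 2"
  using Prim_scale_ge[of 0 s] by simp

text \<open>F3 concerns the primitive; \<open>Prim_le\<close> transfers it to the quotient, since
  \<open>2 * Prim f s / s\<^sup>2 \<le> f s / s\<close>.\<close>

lemma quotient_at_infinity:
  obtains r where "0 < r" "\<And>s. r \<le> \<bar>s\<bar> \<Longrightarrow> A \<le> f s / s"
proof -
  have "\<forall>\<^sub>F s in at_infinity. A / 2 \<le> Prim f s / s\<^sup>2"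
    using Prim_superquadratic unfolding filterlim_at_top by blast
  then obtain b where b: "\<And>s. b \<le> norm s \<Longrightarrow> A / 2 \<le> Prim f s / s\<^sup>2"
    by (auto simp: eventually_at_infinity)
  show ?thesis
  proof (rule that[of "max b 1"])
    fix s :: real assume s: "max b 1 \<le> \<bar>s\<bar>"
    then have "A / 2 \<le> Prim f s / s\<^sup>2" using b[of s] by auto
    also have "\<dots> \<le> (f s * s / 2) / s\<^sup>2" using Prim_le by (intro divide_right_mono) auto
    also have "\<dots> = (f s / s) / 2" using s by (auto simp: power2_eq_square)
    finally show "A \<le> f s / s" by simp
  qed auto
qed

lemma quotient_near_0:
  assumes "0 < a"
  obtains d where "0 < d" "\<And>s. \<bar>s\<bar> < d \<Longrightarrow> f s / s \<le> a"
proof -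
  have "\<forall>\<^sub>F s in at 0. f s / s < a"
    using f_small assms by (rule order_tendstoD)
  then obtain d where d: "0 < d" "\<And>s. s \<noteq> 0 \<Longrightarrow> \<bar>s\<bar> < d \<Longrightarrow> f s / s < a"
    by (auto simp: eventually_at dist_real_def)
  show ?thesis
  proof (rule that[OF d(1)])
    show "f s / s \<le> a" if "\<bar>s\<bar> < d" for s
      using d(2)[of s] that assms by (cases "s = 0") auto
  qed
qed

text \<open>F2 handles values below some \<open>d\<close>. Beyond \<open>d\<close> the constant term
  in F1, which becomes linear after multiplication by \<open>s\<close>, is absorbed in the square
  because \<open>\<bar>s\<bar> \<le> s\<^sup>2 / d\<close>.\<close>

lemma f_times_le:
  obtains C1 where "0 < C1" "\<And>s. f s * s \<le> C1 * (s\<^sup>2 + \<bar>s\<bar> powr p)"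
proof -
  obtain d where d: "0 < d" "\<And>s. \<bar>s\<bar> < d \<Longrightarrow> f s / s \<le> 1"
    using quotient_near_0[of 1] by auto
  define C1 where "C1 = 1 + \<bar>C\<bar> * (1 + 1 / d)"
  have C1: "1 \<le> C1" using d by (simp add: C1_def)
  show ?thesis
  proof (rule that[of C1])
    show "0 < C1" using C1 by simp
    fix s
    show "f s * s \<le> C1 * (s\<^sup>2 + \<bar>s\<bar> powr p)"
    proof (cases "\<bar>s\<bar> < d")
      case True
      have "f s * s \<le> 1 * s\<^sup>2" unfolding f_times_eq using d(2)[OF True] by (intro mult_right_mono) auto
      also have "\<dots> \<le> C1 * (s\<^sup>2 + \<bar>s\<bar> powr p)" using C1 by (intro mult_mono) auto
      finally show ?thesis .
    next
      case False
      then have s: "d \<le> \<bar>s\<bar>" "s \<noteq> 0" using d by auto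
      have "f s * s \<le> \<bar>f s\<bar> * \<bar>s\<bar>" by (metis abs_ge_self abs_mult)
      also have "\<dots> \<le> (\<bar>C\<bar> * (1 + \<bar>s\<bar> powr (p - 1))) * \<bar>s\<bar>"
      proof (rule mult_right_mono)
        have "C * (1 + \<bar>s\<bar> powr (p - 1)) \<le> \<bar>C\<bar> * (1 + \<bar>s\<bar> powr (p - 1))"
          by (intro mult_right_mono add_nonneg_nonneg) auto
        then show "\<bar>f s\<bar> \<le> \<bar>C\<bar> * (1 + \<bar>s\<bar> powr (p - 1))"
          using f_growth[of s] by linarith
      qed auto
      also have "\<dots> = \<bar>C\<bar> * (\<bar>s\<bar> + \<bar>s\<bar> powr (p - 1) * \<bar>s\<bar> powr 1)" by (simp add: algebra_simps)
      also have "\<bar>s\<bar> powr (p - 1) * \<bar>s\<bar> powr 1 = \<bar>s\<bar> powr p" unfolding powr_add[symmetric] by simp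
      also have "\<bar>C\<bar> * (\<bar>s\<bar> + \<bar>s\<bar> powr p) \<le> \<bar>C\<bar> * ((1 / d) * s\<^sup>2 + \<bar>s\<bar> powr p)"
      proof (intro mult_left_mono add_right_mono)
        have "d * \<bar>s\<bar> \<le> \<bar>s\<bar> * \<bar>s\<bar>" using s by (intro mult_right_mono) auto
        then show "\<bar>s\<bar> \<le> (1 / d) * s\<^sup>2" using d(1) by (simp add: field_simps power2_eq_square)
      qed auto
      also have "\<dots> \<le> \<bar>C\<bar> * ((1 + 1 / d) * s\<^sup>2 + (1 + 1 / d) * \<bar>s\<bar> powr p)"
      proof (rule mult_left_mono)
        have "0 \<le> s\<^sup>2" "0 \<le> 1 / d * \<bar>s\<bar> powr p" using d(1) by auto
        then show "(1 / d) * s\<^sup>2 + \<bar>s\<bar> powr p \<le> (1 + 1 / d) * s\<^sup>2 + (1 + 1 / d) * \<bar>s\<bar> powr p"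
          unfolding distrib_right by linarith
      qed auto
      also have "\<dots> = (\<bar>C\<bar> * (1 + 1 / d)) * (s\<^sup>2 + \<bar>s\<bar> powr p)" by (simp add: algebra_simps)
      also have "\<dots> \<le> C1 * (s\<^sup>2 + \<bar>s\<bar> powr p)" by (intro mult_right_mono) (auto simp: C1_def)
      finally show ?thesis .
    qed
  qed
qed

text \<open>Both \<open>a\<close> and \<open>b\<close> may be prescribed arbitrarily small; the
  price is \<open>L\<close>, which multiplies only the mass on values of size at least \<eta>. Small
  values are governed by F2, very large ones by \<open>p < q\<close>.\<close>

lemma Prim_scale_split:
  assumes S: "0 < S" and a: "0 < a" and b: "0 < b" and q: "p < q"
  obtains \<eta> L where "0 < \<eta>" "0 \<le> L"
    "\<And>s. Prim f (S * s) \<le> a * s\<^sup>2 + b * \<bar>s\<bar> powr q + L * (s\<^sup>2 * indicator {s. \<eta> \<le> \<bar>s\<bar>} s)"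
proof -
  obtain d where d: "0 < d" "\<And>s. \<bar>s\<bar> < d \<Longrightarrow> f s / s \<le> 2 * a / S\<^sup>2"
    using quotient_near_0[of "2 * a / S\<^sup>2"] a S by auto
  obtain C1 where C1: "0 < C1" "\<And>s. f s * s \<le> C1 * (s\<^sup>2 + \<bar>s\<bar> powr p)" using f_times_le by blast
  define c where "c = C1 / 2 * S powr p"
  have c: "0 < c" using C1 S by (simp add: c_def)
  \<comment> \<open>The crossover at which \<open>c * l powr p\<close> and
    \<open>b * l powr q\<close> coincide.\<close>
  define l where "l = (b / c) powr (1 / (p - q))"
  have l: "0 < l" "l powr (p - q) = b / c" using b c q by (auto simp: l_def powr_powr)
  define L where "L = C1 / 2 * S\<^sup>2 + c * l powr (p - 2)"
  have split: "\<bar>s\<bar> powr p \<le> b / c * \<bar>s\<bar> powr q + l powr (p - 2) * s\<^sup>2" if "s \<noteq> 0" for s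
  proof (cases "\<bar>s\<bar> \<le> l")
    case True
    have "\<bar>s\<bar> powr p = \<bar>s\<bar> powr (p - 2) * \<bar>s\<bar> powr 2" unfolding powr_add[symmetric] by simp
    also have "\<dots> \<le> l powr (p - 2) * \<bar>s\<bar> powr 2"
      using True p_gt_2 by (intro mult_right_mono powr_mono2) auto
    also have "\<bar>s\<bar> powr 2 = s\<^sup>2" using that by (simp add: powr_numeral)
    finally show ?thesis using b c by (simp add: add_increasing)
  next
    case False
    have "\<bar>s\<bar> powr p = \<bar>s\<bar> powr (p - q) * \<bar>s\<bar> powr q" unfolding powr_add[symmetric] by simp
    also have "\<dots> \<le> l powr (p - q) * \<bar>s\<bar> powr q"
      using False q l by (intro mult_right_mono powr_mono2') auto
    finally show ?thesis by (simp add: l(2) add_increasing2)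
  qed
  show ?thesis
  proof (rule that[of "d / S" L])
    show "0 < d / S" using d S by simp
    show "0 \<le> L" using C1 c by (simp add: L_def)
    fix s
    show "Prim f (S * s) \<le> a * s\<^sup>2 + b * \<bar>s\<bar> powr q + L * (s\<^sup>2 * indicator {s. d / S \<le> \<bar>s\<bar>} s)"
    proof (cases "d / S \<le> \<bar>s\<bar>")
      case False
      then have "\<bar>S * s\<bar> < d" using S by (simp add: field_simps abs_mult)
      then have "f (S * s) / (S * s) * (S * s)\<^sup>2 \<le> 2 * a / S\<^sup>2 * (S * s)\<^sup>2"
        by (intro mult_right_mono d(2)) auto
      also have "\<dots> = 2 * (a * s\<^sup>2)" using S by (simp add: power_mult_distrib)
      finally have "f (S * s) * (S * s) \<le> 2 * (a * s\<^sup>2)" by (simp only: f_times_eq)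
      then have "Prim f (S * s) \<le> a * s\<^sup>2" using Prim_le[of "S * s"] by linarith
      then show ?thesis using False b by (simp add: add_increasing2)
    next
      case True
      then have s: "s \<noteq> 0" using d S by (auto simp: divide_le_0_iff)
      have "Prim f (S * s) \<le> C1 / 2 * ((S * s)\<^sup>2 + \<bar>S * s\<bar> powr p)"
        using Prim_le[of "S * s"] C1(2)[of "S * s"] by linarith
      also have "\<dots> = C1 / 2 * S\<^sup>2 * s\<^sup>2 + c * \<bar>s\<bar> powr p"
        using S by (simp add: c_def abs_mult powr_mult power_mult_distrib algebra_simps)
      also have "\<dots> \<le> C1 / 2 * S\<^sup>2 * s\<^sup>2 + c * (b / c * \<bar>s\<bar> powr q + l powr (p - 2) * s\<^sup>2)"
        using c split[OF s] by (intro add_left_mono mult_left_mono) auto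
      also have "\<dots> = b * \<bar>s\<bar> powr q + L * s\<^sup>2" using c by (simp add: L_def algebra_simps)
      finally have "Prim f (S * s) \<le> b * \<bar>s\<bar> powr q + L * s\<^sup>2" .
      moreover have "0 \<le> a * s\<^sup>2" using a by simp
      ultimately show ?thesis using True by simp
    qed
  qed
qed

end

section \<open>The quadratic form and the Nehari manifold\<close>

lemma grad_weak_gradient:
  assumes "in_H1 u"
  shows "grad u \<in> borel_measurable borel" "integrable lborel (\<lambda>x. (norm (grad u x))\<^sup>2)" "weak_gradient u (grad u)"
proof -
  have "\<exists>g. g \<in> borel_measurable lborel \<and> integrable lborel (\<lambda>x. (norm (g x))\<^sup>2) \<and> weak_gradient u g"
    using assms by (simp add: in_H1_def)
  from someI_ex[OF this] show "grad u \<in> borel_measurable borel" "integrable lborel (\<lambda>x. (norm (grad u x))\<^sup>2)" "weak_gradient u (grad u)"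
    unfolding grad_def by auto
qed

lemma weak_gradient_scale:
  assumes "weak_gradient u g"
  shows "weak_gradient (\<lambda>x. t * u x) (\<lambda>x. t *\<^sub>R g x)"
  using assms unfolding weak_gradient_def by (simp add: mult.assoc)

lemma in_H1_scale:
  assumes "in_H1 u"
  shows "in_H1 (\<lambda>x. t * u x)"
proof -
  note g = grad_weak_gradient[OF assms]
  have "(\<lambda>x. t *\<^sub>R grad u x) \<in> borel_measurable lborel" using g(1) by simp
  moreover have "integrable lborel (\<lambda>x. (norm (t *\<^sub>R grad u x))\<^sup>2)"
    using g(2) by (simp add: power_mult_distrib)
  moreover note weak_gradient_scale[OF g(3), of t]
  moreover have "(\<lambda>x. t * u x) \<in> borel_measurable lborel" "integrable lborel (\<lambda>x. (t * u x)\<^sup>2)"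
    using assms by (auto simp: in_H1_def power_mult_distrib)
  ultimately show ?thesis unfolding in_H1_def by blast
qed

lemma grad_scale:
  assumes "in_H1 u"
  shows "AE x in lborel. grad (\<lambda>x. t * u x) x = t *\<^sub>R grad u x"
proof (rule weak_gradient_unique)
  note g = grad_weak_gradient[OF assms]
  show "(\<lambda>x. t *\<^sub>R grad u x) \<in> borel_measurable borel" using g(1) by simp
  show "integrable lborel (\<lambda>x. (norm (t *\<^sub>R grad u x))\<^sup>2)"
    using g(2) by (simp add: power_mult_distrib)
  show "weak_gradient (\<lambda>x. t * u x) (\<lambda>x. t *\<^sub>R grad u x)"
    by (rule weak_gradient_scale[OF g(3)])
qed (use grad_weak_gradient[OF in_H1_scale[OF assms]] in auto)

lemma YG_D:
  assumes "u \<in> YG"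
  shows "in_H1 u" "u \<in> borel_measurable borel" "integrable lborel (\<lambda>x. (u x)\<^sup>2)"
    "integrable lborel (\<lambda>x. (u x)\<^sup>2 / (norm (fst x))\<^sup>2)"
  using assms by (auto simp: YG_def in_Y_def in_H1_def)

lemma YG_scale:
  assumes "u \<in> YG"
  shows "(\<lambda>x. t * u x) \<in> YG"
proof -
  have "integrable lborel (\<lambda>x. (t * u x)\<^sup>2 / (norm (fst x))\<^sup>2)"
    using YG_D(4)[OF assms] by (simp add: power_mult_distrib flip: times_divide_eq_right)
  then show ?thesis
    using assms in_H1_scale[of u t] by (auto simp: YG_def in_Y_def G_invariant_def)
qed

lemma integrable_potential_square:
  assumes "Linf_pot W" "u \<in> borel_measurable borel" "integrable lborel (\<lambda>x. (u x)\<^sup>2)"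
  shows "integrable lborel (\<lambda>x. W x * (u x)\<^sup>2)"
proof -
  have [measurable]: "W \<in> borel_measurable borel" "u \<in> borel_measurable borel"
    using assms by (auto simp: Linf_pot_def)
  obtain b where b: "\<And>x. \<bar>W x\<bar> \<le> b"
    using assms(1) by (auto simp: Linf_pot_def bounded_iff)
  show ?thesis
  proof (rule Bochner_Integration.integrable_bound)
    show "integrable lborel (\<lambda>x. b * (u x)\<^sup>2)" using assms by auto
    have "\<bar>W x\<bar> * (u x)\<^sup>2 \<le> \<bar>b\<bar> * (u x)\<^sup>2" for x
      using b[of x] by (intro mult_right_mono) auto
    then show "AE x in lborel. norm (W x * (u x)\<^sup>2) \<le> norm (b * (u x)\<^sup>2)"
      by (simp add: abs_mult)
  qed measurable
qed

lemma Qform_split: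
  assumes "u \<in> YG" "Linf_pot W"
  shows "Qform W u = (\<integral>x. (norm (grad u x))\<^sup>2 \<partial>lborel) + (\<integral>x. (u x)\<^sup>2 / (norm (fst x))\<^sup>2 \<partial>lborel)
     + (\<integral>x. W x * (u x)\<^sup>2 \<partial>lborel)"
  using grad_weak_gradient(2)[OF YG_D(1)[OF assms(1)]] YG_D(4)[OF assms(1)]
    integrable_potential_square[OF assms(2) YG_D(2,3)[OF assms(1)]]
  unfolding Qform_def by simp

lemma Qform_scale:
  assumes "u \<in> YG" "Linf_pot W"
  shows "Qform W (\<lambda>x. t * u x) = t\<^sup>2 * Qform W u"
proof -
  have "(\<integral>x. (norm (grad (\<lambda>x. t * u x) x))\<^sup>2 \<partial>lborel) = (\<integral>x. t\<^sup>2 * (norm (grad u x))\<^sup>2 \<partial>lborel)"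
  proof (rule integral_cong_AE)
    show "AE x in lborel. (norm (grad (\<lambda>x. t * u x) x))\<^sup>2 = t\<^sup>2 * (norm (grad u x))\<^sup>2"
      using grad_scale[OF YG_D(1)[OF assms(1)], of t]
      by eventually_elim (simp add: power_mult_distrib)
  qed (use grad_weak_gradient(1)[OF YG_D(1)[OF assms(1)]] grad_weak_gradient(1)[OF YG_D(1)[OF YG_scale[OF assms(1), of t]]] in auto)
  moreover have "(\<integral>x. (t * u x)\<^sup>2 / (norm (fst x))\<^sup>2 \<partial>lborel) = t\<^sup>2 * (\<integral>x. (u x)\<^sup>2 / (norm (fst x))\<^sup>2 \<partial>lborel)"
    by (simp add: power_mult_distrib flip: times_divide_eq_right)
  moreover have "(\<integral>x. W x * (t * u x)\<^sup>2 \<partial>lborel) = t\<^sup>2 * (\<integral>x. W x * (u x)\<^sup>2 \<partial>lborel)"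
  proof -
    have "W x * (t * u x)\<^sup>2 = t\<^sup>2 * (W x * (u x)\<^sup>2)" for x
      by (simp add: power2_eq_square)
    then show ?thesis by (simp only: integral_mult_right_zero)
  qed
  ultimately show ?thesis
    using assms YG_scale[OF assms(1)] by (simp add: Qform_split algebra_simps)
qed

lemma Qform_diff_le:
  assumes "u \<in> YG" "Linf_pot W" "Linf_pot W'" "AE x in lborel. \<bar>W' x - W x\<bar> \<le> \<epsilon>"
  shows "Qform W' u \<le> Qform W u + \<epsilon> * (\<integral>x. (u x)\<^sup>2 \<partial>lborel)"
proof -
  note i = integrable_potential_square[OF assms(2) YG_D(2,3)[OF assms(1)]]
    integrable_potential_square[OF assms(3) YG_D(2,3)[OF assms(1)]]
  have "(\<integral>x. W' x * (u x)\<^sup>2 \<partial>lborel) \<le> (\<integral>x. W x * (u x)\<^sup>2 + \<epsilon> * (u x)\<^sup>2 \<partial>lborel)"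
  proof (rule integral_mono_AE)
    show "integrable lborel (\<lambda>x. W x * (u x)\<^sup>2 + \<epsilon> * (u x)\<^sup>2)" using i YG_D(3)[OF assms(1)] by auto
    show "AE x in lborel. W' x * (u x)\<^sup>2 \<le> W x * (u x)\<^sup>2 + \<epsilon> * (u x)\<^sup>2"
      using assms(4)
    proof eventually_elim
      fix x assume "\<bar>W' x - W x\<bar> \<le> \<epsilon>"
      then have "W' x * (u x)\<^sup>2 \<le> (W x + \<epsilon>) * (u x)\<^sup>2" by (intro mult_right_mono) auto
      then show "W' x * (u x)\<^sup>2 \<le> W x * (u x)\<^sup>2 + \<epsilon> * (u x)\<^sup>2" by (simp add: distrib_right)
    qed
  qed (use i in auto)
  also have "\<dots> = (\<integral>x. W x * (u x)\<^sup>2 \<partial>lborel) + \<epsilon> * (\<integral>x. (u x)\<^sup>2 \<partial>lborel)"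
    using i YG_D(3)[OF assms(1)] by simp
  finally show ?thesis using assms by (simp add: Qform_split)
qed

lemma Qform_ge:
  assumes "u \<in> YG" "Linf_pot W" "AE x in lborel. w \<le> W x"
  shows "(\<integral>x. (norm (grad u x))\<^sup>2 \<partial>lborel) + w * (\<integral>x. (u x)\<^sup>2 \<partial>lborel) \<le> Qform W u"
proof -
  note i = integrable_potential_square[OF assms(2) YG_D(2,3)[OF assms(1)]]
  have "w * (\<integral>x. (u x)\<^sup>2 \<partial>lborel) = (\<integral>x. w * (u x)\<^sup>2 \<partial>lborel)" by simp
  also have "\<dots> \<le> (\<integral>x. W x * (u x)\<^sup>2 \<partial>lborel)"
  proof (rule integral_mono_AE)
    show "AE x in lborel. w * (u x)\<^sup>2 \<le> W x * (u x)\<^sup>2"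
      using assms(3) by eventually_elim (auto intro: mult_right_mono)
  qed (use i YG_D(3)[OF assms(1)] in auto)
  finally have "w * (\<integral>x. (u x)\<^sup>2 \<partial>lborel) \<le> (\<integral>x. W x * (u x)\<^sup>2 \<partial>lborel)" .
  moreover have "0 \<le> (\<integral>x. (u x)\<^sup>2 / (norm (fst x))\<^sup>2 \<partial>lborel)"
    by (intro integral_nonneg_AE) auto
  ultimately show ?thesis unfolding Qform_split[OF assms(1,2)] by linarith
qed

lemma integral_square_pos:
  fixes u :: "'a \<Rightarrow> real"
  assumes "integrable M (\<lambda>x. (u x)\<^sup>2)" "\<not> (AE x in M. u x = 0)"
  shows "0 < (\<integral>x. (u x)\<^sup>2 \<partial>M)"
proof -
  have "0 \<le> (\<integral>x. (u x)\<^sup>2 \<partial>M)" by (intro integral_nonneg_AE) auto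
  moreover have "(\<integral>x. (u x)\<^sup>2 \<partial>M) \<noteq> 0"
    using assms integral_nonneg_eq_0_iff_AE[OF assms(1)] by auto
  ultimately show ?thesis by linarith
qed

lemma Qform_pos:
  assumes "u \<in> YG" "Linf_pot W" "AE x in lborel. w \<le> W x" "0 < w" "\<not> (AE x in lborel. u x = 0)"
  shows "0 < Qform W u"
proof -
  have "0 < w * (\<integral>x. (u x)\<^sup>2 \<partial>lborel)"
    using assms integral_square_pos[OF YG_D(3)[OF assms(1)]] by simp
  moreover have "0 \<le> (\<integral>x. (norm (grad u x))\<^sup>2 \<partial>lborel)" by (intro integral_nonneg_AE) auto
  ultimately show ?thesis using Qform_ge[OF assms(1-3)] by linarith
qed

lemma YG_H1_ball:
  assumes "u \<in> YG" "(\<integral>x. (u x)\<^sup>2 \<partial>lborel) + (\<integral>x. (norm (grad u x))\<^sup>2 \<partial>lborel) \<le> B"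
  shows "H1_ball B u"
  using YG_D[OF assms(1)] grad_weak_gradient[OF YG_D(1)[OF assms(1)]] assms(2)
  unfolding H1_ball_def by blast

lemma YG_Lq_integrable:
  fixes u :: "(real^'k) \<times> (real^'m) \<Rightarrow> real"
  assumes u: "u \<in> YG" and q: "2 \<le> q"
    "(real DIM((real^'k) \<times> (real^'m)) - 2) * q < 2 * real DIM((real^'k) \<times> (real^'m))"
  shows "integrable lborel (\<lambda>x. \<bar>u x\<bar> powr q)"
proof -
  define B where "B = (\<integral>x. (u x)\<^sup>2 \<partial>lborel) + (\<integral>x. (norm (grad u x))\<^sup>2 \<partial>lborel)"
  have "0 \<le> B" unfolding B_def by (intro add_nonneg_nonneg integral_nonneg_AE) auto
  from H1_ball_Lq_bounded[OF q this] obtain M where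
    "\<And>v::(real^'k) \<times> (real^'m) \<Rightarrow> real. H1_ball B v \<Longrightarrow> (\<integral>\<^sup>+x. ennreal (\<bar>v x\<bar> powr q) \<partial>lborel) \<le> ennreal M"
    by blast
  from this[OF YG_H1_ball[OF u]] have "(\<integral>\<^sup>+x. ennreal (\<bar>u x\<bar> powr q) \<partial>lborel) \<le> ennreal M"
    by (simp add: B_def)
  then show ?thesis
    using YG_D(2)[OF u] by (intro integrableI_nonneg) (auto intro: le_less_trans)
qed

section \<open>The fiber map along a ray\<close>

context superquadratic
begin

text \<open>The integral of f(tu)tu with t^2 divided out. As \<open>Qform\<close> is quadratic, for
  t > 0 the Nehari condition on \<open>t * u\<close> becomes \<open>fiber u t = Qform W u\<close>:
  the left side does not see the potential and increases with \<open>t\<close>, the right side does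
  not depend on \<open>t\<close>. Division by zero gives \<open>fiber u 0 = 0\<close>.\<close>

definition fiber :: "('a::euclidean_space \<Rightarrow> real) \<Rightarrow> real \<Rightarrow> real" where
  "fiber u t = (\<integral>x. f (t * u x) / (t * u x) * (u x)\<^sup>2 \<partial>lborel)"

lemma quotient_measurable [measurable]: "(\<lambda>s. f s / s) \<in> borel_measurable borel"
  using quotient_continuous by (rule borel_measurable_continuous_onI)

context
  fixes u :: "'a::euclidean_space \<Rightarrow> real"
  assumes um [measurable]: "u \<in> borel_measurable borel"
    and u2: "integrable lborel (\<lambda>x. (u x)\<^sup>2)" and up: "integrable lborel (\<lambda>x. \<bar>u x\<bar> powr p)"
begin

lemma integrable_f_times: "integrable lborel (\<lambda>x. f (t * u x) * (t * u x))"
proof -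
  obtain C1 where C1: "0 < C1" "\<And>s. f s * s \<le> C1 * (s\<^sup>2 + \<bar>s\<bar> powr p)" using f_times_le by blast
  show ?thesis
  proof (rule Bochner_Integration.integrable_bound)
    show "integrable lborel (\<lambda>x. C1 * (t\<^sup>2 * (u x)\<^sup>2 + \<bar>t\<bar> powr p * \<bar>u x\<bar> powr p))"
      using u2 up by auto
    have nn: "0 \<le> f s * s" for s unfolding f_times_eq by (intro mult_nonneg_nonneg quotient_nonneg) auto
    have "\<bar>f (t * u x) * (t * u x)\<bar> \<le> \<bar>C1 * (t\<^sup>2 * (u x)\<^sup>2 + \<bar>t\<bar> powr p * \<bar>u x\<bar> powr p)\<bar>" for x
    proof -
      have "(t * u x)\<^sup>2 + \<bar>t * u x\<bar> powr p = t\<^sup>2 * (u x)\<^sup>2 + \<bar>t\<bar> powr p * \<bar>u x\<bar> powr p"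
        by (simp add: power_mult_distrib abs_mult powr_mult)
      then show ?thesis using C1(2)[of "t * u x"] nn[of "t * u x"] by simp
    qed
    then show "AE x in lborel. norm (f (t * u x) * (t * u x)) \<le> norm (C1 * (t\<^sup>2 * (u x)\<^sup>2 + \<bar>t\<bar> powr p * \<bar>u x\<bar> powr p))"
      by simp
  qed measurable
qed

lemma integrable_Prim: "integrable lborel (\<lambda>x. Prim f (t * u x))"
proof (rule Bochner_Integration.integrable_bound[OF integrable_f_times[of t]])
  have "\<bar>Prim f s\<bar> \<le> \<bar>f s * s\<bar>" for s
    using Prim_nonneg[of s] Prim_le[of s] by linarith
  then show "AE x in lborel. norm (Prim f (t * u x)) \<le> norm (f (t * u x) * (t * u x))" by simp
qed measurable

lemma f_times_scale_eq: "f (t * s) * (t * s) = t\<^sup>2 * (f (t * s) / (t * s) * s\<^sup>2)"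
  by (cases "t * s = 0") (auto simp: power2_eq_square)

lemma integrable_fiber: "integrable lborel (\<lambda>x. f (t * u x) / (t * u x) * (u x)\<^sup>2)"
proof (cases "t = 0")
  case False
  have "integrable lborel (\<lambda>x. (1 / t\<^sup>2) * (f (t * u x) * (t * u x)))"
    by (intro integrable_mult_right integrable_f_times)
  also have "(\<lambda>x. (1 / t\<^sup>2) * (f (t * u x) * (t * u x))) = (\<lambda>x. f (t * u x) / (t * u x) * (u x)\<^sup>2)"
    unfolding f_times_scale_eq using False by simp
  finally show ?thesis .
qed simp

lemma integral_f_times: "(\<integral>x. f (t * u x) * (t * u x) \<partial>lborel) = t\<^sup>2 * fiber u t"
  by (simp only: f_times_scale_eq fiber_def integral_mult_right_zero)

lemma fiber_mono:
  assumes "0 \<le> s" "s \<le> t"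
  shows "fiber u s \<le> fiber u t"
  unfolding fiber_def
  by (intro integral_mono integrable_fiber mult_right_mono quotient_scale_mono assms) auto

text \<open>By monotonicity in the parameter, the integrand at the right end \<open>T\<close>
  dominates all the others.\<close>

lemma fiber_continuous: "continuous_on {0..T} (fiber u)"
  unfolding continuous_on_sequentially
proof (intro allI ballI impI, elim conjE)
  fix X t assume t: "t \<in> {0..T}" and X: "\<forall>n. X n \<in> {0..T}" and lim: "X \<longlonglongrightarrow> t"
  have "(\<lambda>n. fiber u (X n)) \<longlonglongrightarrow> fiber u t"
    unfolding fiber_def
  proof (rule integral_dominated_convergence)
    show "integrable lborel (\<lambda>x. f (T * u x) / (T * u x) * (u x)\<^sup>2)" by (rule integrable_fiber)
    show "AE x in lborel. (\<lambda>n. f (X n * u x) / (X n * u x) * (u x)\<^sup>2) \<longlonglongrightarrow> f (t * u x) / (t * u x) * (u x)\<^sup>2"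
    proof (intro AE_I2 tendsto_mult_right)
      fix x
      have "(\<lambda>n. X n * u x) \<longlonglongrightarrow> t * u x" by (intro tendsto_intros lim)
      then show "(\<lambda>n. f (X n * u x) / (X n * u x)) \<longlonglongrightarrow> f (t * u x) / (t * u x)"
        using quotient_continuous by (intro isCont_tendsto_compose[where g="\<lambda>s. f s / s"]) (auto simp: continuous_on_eq_continuous_at)
    qed
    fix n
    have "\<bar>f (X n * u x) / (X n * u x)\<bar> * (u x)\<^sup>2 \<le> f (T * u x) / (T * u x) * (u x)\<^sup>2" for x
      using X quotient_nonneg[of "X n * u x"] quotient_scale_mono[of "X n" T "u x"] by (intro mult_right_mono) auto
    then show "AE x in lborel. norm (f (X n * u x) / (X n * u x) * (u x)\<^sup>2) \<le> f (T * u x) / (T * u x) * (u x)\<^sup>2"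
      by (simp only: real_norm_def abs_mult abs_power2) simp
  qed measurable
  then show "(fiber u \<circ> X) \<longlonglongrightarrow> fiber u t" by (simp add: o_def)
qed

text \<open>Where \<open>\<bar>u x\<bar> \<ge> \<eta>\<close>, the argument \<open>t * u x\<close>
  already has size \<open>r\<close>, so the quotient is at least \<open>A\<close>; elsewhere it is
  nonnegative.\<close>

lemma fiber_ge:
  assumes r: "\<And>s. r \<le> \<bar>s\<bar> \<Longrightarrow> A \<le> f s / s" and \<eta>: "0 < \<eta>" and t: "0 \<le> t" "r \<le> t * \<eta>"
  shows "A * (\<integral>x. (u x)\<^sup>2 * indicator {s. \<eta> \<le> \<bar>s\<bar>} (u x) \<partial>lborel) \<le> fiber u t"
proof -
  have ii: "integrable lborel (\<lambda>x. (u x)\<^sup>2 * indicator {s. \<eta> \<le> \<bar>s\<bar>} (u x))"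
    by (rule Bochner_Integration.integrable_bound[OF u2]) (auto simp: indicator_def)
  have "A * (\<integral>x. (u x)\<^sup>2 * indicator {s. \<eta> \<le> \<bar>s\<bar>} (u x) \<partial>lborel) = (\<integral>x. A * ((u x)\<^sup>2 * indicator {s. \<eta> \<le> \<bar>s\<bar>} (u x)) \<partial>lborel)"
    by simp
  also have "\<dots> \<le> fiber u t"
    unfolding fiber_def
  proof (rule integral_mono[OF _ integrable_fiber])
    fix x
    show "A * ((u x)\<^sup>2 * indicator {s. \<eta> \<le> \<bar>s\<bar>} (u x)) \<le> f (t * u x) / (t * u x) * (u x)\<^sup>2"
    proof (cases "\<eta> \<le> \<bar>u x\<bar>")
      case True
      then have "t * \<eta> \<le> \<bar>t * u x\<bar>" using t by (simp add: abs_mult mult_left_mono)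
      then have "A * (u x)\<^sup>2 \<le> f (t * u x) / (t * u x) * (u x)\<^sup>2"
        using t by (intro mult_right_mono r) auto
      then show ?thesis using True by simp
    next
      case False
      then show ?thesis using quotient_nonneg[of "t * u x"] by (simp del: times_divide_eq_left)
    qed
  qed (use ii in auto)
  finally show ?thesis .
qed

text \<open>A nonzero \<open>u\<close> has positive mass on some superlevel set. With
  \<open>A\<close> equal to \<open>Q\<close> divided by this mass, the previous bound lifts the
  fiber map to \<open>Q\<close>, and the intermediate value theorem applies from its value 0 at
  0.\<close>

lemma fiber_attains:
  assumes nz: "\<not> (AE x in lborel. u x = 0)" and Q: "0 < Q"
  obtains t where "0 < t" "fiber u t = Q"
proof -
  have "\<exists>n. 0 < (\<integral>x. (u x)\<^sup>2 * indicator {s. 1 / real (Suc n) \<le> \<bar>s\<bar>} (u x) \<partial>lborel)"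
  proof (rule ccontr)
    assume neg: "\<not> ?thesis"
    have "AE x in lborel. (u x)\<^sup>2 * indicator {s. 1 / real (Suc n) \<le> \<bar>s\<bar>} (u x) = 0" for n
    proof -
      have ii: "integrable lborel (\<lambda>x. (u x)\<^sup>2 * indicator {s. 1 / real (Suc n) \<le> \<bar>s\<bar>} (u x))"
        by (rule Bochner_Integration.integrable_bound[OF u2]) (auto simp: indicator_def)
      have "0 \<le> (\<integral>x. (u x)\<^sup>2 * indicator {s. 1 / real (Suc n) \<le> \<bar>s\<bar>} (u x) \<partial>lborel)"
        by (intro integral_nonneg_AE) auto
      moreover have "\<not> 0 < (\<integral>x. (u x)\<^sup>2 * indicator {s. 1 / real (Suc n) \<le> \<bar>s\<bar>} (u x) \<partial>lborel)"
        using neg by blast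
      ultimately have "(\<integral>x. (u x)\<^sup>2 * indicator {s. 1 / real (Suc n) \<le> \<bar>s\<bar>} (u x) \<partial>lborel) = 0"
        by linarith
      then show ?thesis using integral_nonneg_eq_0_iff_AE[OF ii] by auto
    qed
    then have "AE x in lborel. \<forall>n. (u x)\<^sup>2 * indicator {s. 1 / real (Suc n) \<le> \<bar>s\<bar>} (u x) = 0"
      by (subst AE_all_countable) blast
    then have "AE x in lborel. u x = 0"
    proof eventually_elim
      fix x assume *: "\<forall>n. (u x)\<^sup>2 * indicator {s. 1 / real (Suc n) \<le> \<bar>s\<bar>} (u x) = 0"
      show "u x = 0"
      proof (rule ccontr)
        assume "u x \<noteq> 0"
        then obtain n where "inverse (real (Suc n)) < \<bar>u x\<bar>" using reals_Archimedean[of "\<bar>u x\<bar>"] by auto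
        then show False using *[rule_format, of n] \<open>u x \<noteq> 0\<close> by (simp add: indicator_def inverse_eq_divide)
      qed
    qed
    then show False using nz by simp
  qed
  then obtain \<eta> where \<eta>: "0 < \<eta>" and pos: "0 < (\<integral>x. (u x)\<^sup>2 * indicator {s. \<eta> \<le> \<bar>s\<bar>} (u x) \<partial>lborel)"
    by (metis of_nat_0_less_iff zero_less_Suc zero_less_divide_1_iff)
  define I where "I = (\<integral>x. (u x)\<^sup>2 * indicator {s. \<eta> \<le> \<bar>s\<bar>} (u x) \<partial>lborel)"
  obtain r where r: "0 < r" "\<And>s. r \<le> \<bar>s\<bar> \<Longrightarrow> Q / I \<le> f s / s" using quotient_at_infinity by blast
  have "Q / I * I \<le> fiber u (r / \<eta>)"
    unfolding I_def by (rule fiber_ge[OF r(2)[unfolded I_def] \<eta>]) (use r \<eta> in auto)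
  then have up: "Q \<le> fiber u (r / \<eta>)" using pos by (simp add: I_def)
  have z: "fiber u 0 = 0" by (simp add: fiber_def)
  obtain t where t: "0 \<le> t" "t \<le> r / \<eta>" "fiber u t = Q"
    using IVT'[of "fiber u" 0 Q "r / \<eta>"] fiber_continuous up z Q r \<eta> by auto
  have "t \<noteq> 0" using t z Q by auto
  then have "0 < t" using t(1) by simp
  then show ?thesis using t(3) by (rule that)
qed

end

section \<open>The Nehari manifold: rays, energies and change of potential\<close>

lemma nehari_D:
  assumes "u \<in> nehari f W"
  shows "u \<in> YG" "\<not> (AE x in lborel. u x = 0)" "Qform W u = (\<integral>x. f (u x) * u x \<partial>lborel)"
  using assms by (auto simp: nehari_def)

context
  fixes dim :: "((real^'k) \<times> (real^'m)) itself"
  assumes subcritical: "(real DIM((real^'k) \<times> (real^'m)) - 2) * p < 2 * real DIM((real^'k) \<times> (real^'m))"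
begin

lemma YG_Lp:
  fixes u :: "(real^'k) \<times> (real^'m) \<Rightarrow> real"
  assumes "u \<in> YG"
  shows "u \<in> borel_measurable borel" "integrable lborel (\<lambda>x. (u x)\<^sup>2)" "integrable lborel (\<lambda>x. \<bar>u x\<bar> powr p)"
  using YG_D[OF assms] YG_Lq_integrable[OF assms, of p] subcritical p_gt_2 by auto

lemma scale_in_nehari_iff:
  fixes u :: "(real^'k) \<times> (real^'m) \<Rightarrow> real"
  assumes "u \<in> YG" "Linf_pot W" "\<not> (AE x in lborel. u x = 0)" "0 < t"
  shows "(\<lambda>x. t * u x) \<in> nehari f W \<longleftrightarrow> fiber u t = Qform W u"
  using assms YG_scale[OF assms(1), of t] Qform_scale[OF assms(1,2), of t] integral_f_times[OF YG_Lp[OF assms(1)], of t]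
  by (auto simp: nehari_def)

lemma nehari_scale_exists:
  fixes u :: "(real^'k) \<times> (real^'m) \<Rightarrow> real"
  assumes "u \<in> YG" "Linf_pot W" "AE x in lborel. w \<le> W x" "0 < w" "\<not> (AE x in lborel. u x = 0)"
  obtains t where "0 < t" "(\<lambda>x. t * u x) \<in> nehari f W"
  using fiber_attains[OF YG_Lp[OF assms(1)] assms(5) Qform_pos[OF assms]]
    scale_in_nehari_iff[OF assms(1,2,5)] by metis

text \<open>The Nehari identity rewrites \<open>Qform\<close> as the integral of
  \<open>f (u x) * u x\<close>, after which the claim is the pointwise inequality
  \<open>Prim_scale_ge\<close> integrated.\<close>

lemma JW_scale_le:
  fixes u :: "(real^'k) \<times> (real^'m) \<Rightarrow> real"
  assumes u: "u \<in> nehari f W" and W: "Linf_pot W" and t: "0 \<le> t"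
  shows "JW f W (\<lambda>x. t * u x) \<le> JW f W u"
proof -
  note Y = nehari_D(1)[OF u]
  note Lp = YG_Lp[OF Y]
  have i: "integrable lborel (\<lambda>x. Prim f (u x))" "integrable lborel (\<lambda>x. f (u x) * u x)"
    using integrable_Prim[OF Lp, of 1] integrable_f_times[OF Lp, of 1] by auto
  have "(\<integral>x. Prim f (u x) \<partial>lborel) + (t\<^sup>2 - 1) / 2 * Qform W u
     = (\<integral>x. Prim f (u x) + (t\<^sup>2 - 1) / 2 * (f (u x) * u x) \<partial>lborel)"
    using i nehari_D(3)[OF u] by simp
  also have "\<dots> \<le> (\<integral>x. Prim f (t * u x) \<partial>lborel)"
    using i by (intro integral_mono integrable_Prim[OF Lp] Prim_scale_ge t) auto
  finally show ?thesis
    unfolding JW_def Qform_scale[OF Y W] by (simp add: field_simps)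
qed

lemma JW_nehari_nonneg:
  fixes u :: "(real^'k) \<times> (real^'m) \<Rightarrow> real"
  assumes u: "u \<in> nehari f W" and W: "Linf_pot W"
  shows "0 \<le> JW f W u"
  using JW_scale_le[OF assms, of 0] Qform_scale[OF nehari_D(1)[OF u] W, of 0] by (simp add: JW_def)

text \<open>A normalised Nehari function of bounded energy cannot be small: if \<open>v\<close> had little mass
  on \<open>{\<bar>v\<bar> \<ge> \<eta>}\<close>, then \<open>\<integral>F(Sv) \<le> 1\<close> for a large \<open>S\<close>, and the energy at \<open>S v\<close>, which is at
  most that of the Nehari function on the ray, would exceed \<open>D\<close>. Hence superlinearity bounds
  the fiber parameter uniformly.\<close>

lemma fiber_parameter_bounded:
  assumes D: "0 \<le> D" and w: "0 < w"
  obtains R where "0 \<le> R"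
    "\<And>W (v :: (real^'k) \<times> (real^'m) \<Rightarrow> real) m t.
       Linf_pot W \<Longrightarrow> (AE x in lborel. w \<le> W x) \<Longrightarrow> v \<in> YG \<Longrightarrow> Qform W v = 1 \<Longrightarrow> 0 < m \<Longrightarrow>
       (\<lambda>x. m * v x) \<in> nehari f W \<Longrightarrow> JW f W (\<lambda>x. m * v x) \<le> D \<Longrightarrow> 0 \<le> t \<Longrightarrow> fiber v t \<le> 2 \<Longrightarrow> t \<le> R"
proof -
  define N where "N = real DIM((real^'k) \<times> (real^'m))"
  \<comment> \<open>Room above \<open>p\<close> is needed to control large values with a small
    coefficient.\<close>
  have "\<exists>q>p. (N - 2) * q < 2 * N"
  proof (cases "N > 2")
    case True
    then have "p < 2 * N / (N - 2)" using subcritical by (simp add: N_def field_simps)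
    then obtain q where "p < q" "q < 2 * N / (N - 2)" using dense by blast
    then show ?thesis using True by (auto simp: field_simps)
  next
    case False
    have "(N - 2) * (p + 1) \<le> 0" using False p_gt_2 by (intro mult_nonpos_nonneg) auto
    moreover have "0 < N"
      unfolding N_def of_nat_0_less_iff by (rule DIM_positive)
    ultimately show ?thesis by (intro exI[of _ "p + 1"]) auto
  qed
  then obtain q where q: "p < q" "(N - 2) * q < 2 * N" by blast
  have q2: "2 \<le> q" using q(1) p_gt_2 by simp
  note qN = q(2)[unfolded N_def]
  \<comment> \<open>Normalisation gives 1 as bound for the gradient integral and 1/w for the
    integral of the square.\<close>
  define B where "B = 1 / w + 1"
  have B0: "0 \<le> B" using w by (simp add: B_def)
  obtain M where M: "\<And>v::(real^'k) \<times> (real^'m) \<Rightarrow> real. H1_ball B v \<Longrightarrow> (\<integral>\<^sup>+x. ennreal (\<bar>v x\<bar> powr q) \<partial>lborel) \<le> ennreal M"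
    using H1_ball_Lq_bounded[OF q2 qN B0] by blast
  define M' where "M' = max M 1"
  \<comment> \<open>At \<open>S * v\<close> the quadratic part of the energy is D + 2, so even after
    subtracting 1 it exceeds D.\<close>
  define S where "S = sqrt (2 * (D + 2))"
  have S: "0 < S" "S\<^sup>2 = 2 * (D + 2)" using D by (auto simp: S_def)
  \<comment> \<open>The coefficients make the quadratic term and the L^q term contribute at most 1/3
    each; the third 1/3 is left for the mass term.\<close>
  obtain \<eta> L where \<eta>: "0 < \<eta>" "0 \<le> L" and split:
    "\<And>s. Prim f (S * s) \<le> w / 3 * s\<^sup>2 + 1 / (3 * M') * \<bar>s\<bar> powr q + L * (s\<^sup>2 * indicator {s. \<eta> \<le> \<bar>s\<bar>} s)"
    using Prim_scale_split[OF S(1), of "w / 3" "1 / (3 * M')" q] w q by (auto simp: M'_def)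
  define \<delta> where "\<delta> = 1 / (3 * (L + 1))"
  have \<delta>: "0 < \<delta>" "L * \<delta> \<le> 1 / 3" using \<eta> by (auto simp: \<delta>_def field_simps)
  \<comment> \<open>Mass at least \<delta> on the superlevel set then makes the fiber map at least
    3, beyond the allowed 2.\<close>
  obtain r where r: "0 < r" "\<And>s. r \<le> \<bar>s\<bar> \<Longrightarrow> 3 / \<delta> \<le> f s / s" using quotient_at_infinity by blast
  show ?thesis
  proof (rule that[of "r / \<eta>"])
    show "0 \<le> r / \<eta>" using r \<eta> by simp
    fix W and v :: "(real^'k) \<times> (real^'m) \<Rightarrow> real" and m t :: real
    assume W: "Linf_pot W" "AE x in lborel. w \<le> W x" and v: "v \<in> YG" "Qform W v = 1"
      and m: "0 < m" "(\<lambda>x. m * v x) \<in> nehari f W" "JW f W (\<lambda>x. m * v x) \<le> D"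
      and t: "0 \<le> t" "fiber v t \<le> 2"
    note Lp = YG_Lp[OF v(1)]
    have [measurable]: "v \<in> borel_measurable borel" by (rule Lp(1))
    have g0: "0 \<le> (\<integral>x. (norm (grad v x))\<^sup>2 \<partial>lborel)" and v0: "0 \<le> (\<integral>x. (v x)\<^sup>2 \<partial>lborel)"
      by (intro integral_nonneg_AE, simp)+
    have le1: "(\<integral>x. (norm (grad v x))\<^sup>2 \<partial>lborel) + w * (\<integral>x. (v x)\<^sup>2 \<partial>lborel) \<le> 1"
      using Qform_ge[OF v(1) W] v(2) by simp
    then have v2w: "w * (\<integral>x. (v x)\<^sup>2 \<partial>lborel) \<le> 1" using g0 by linarith
    then have v2: "(\<integral>x. (v x)\<^sup>2 \<partial>lborel) \<le> 1 / w" using w by (simp add: field_simps)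
    have "0 \<le> w * (\<integral>x. (v x)\<^sup>2 \<partial>lborel)" using w v0 by simp
    then have "(\<integral>x. (norm (grad v x))\<^sup>2 \<partial>lborel) \<le> 1" using le1 by linarith
    then have "H1_ball B v" using v2 by (intro YG_H1_ball v(1)) (simp add: B_def)
    from M[OF this] have "(\<integral>\<^sup>+x. ennreal (\<bar>v x\<bar> powr q) \<partial>lborel) \<le> ennreal M'"
      by (rule order_trans) (auto intro: ennreal_leI simp: M'_def)
    moreover have vq: "integrable lborel (\<lambda>x. \<bar>v x\<bar> powr q)"
      by (rule YG_Lq_integrable[OF v(1) q2 qN])
    ultimately have vqM: "(\<integral>x. \<bar>v x\<bar> powr q \<partial>lborel) \<le> M'"
      by (subst (asm) nn_integral_eq_integral) (auto simp: M'_def)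
    define I where "I = (\<integral>x. (v x)\<^sup>2 * indicator {s. \<eta> \<le> \<bar>s\<bar>} (v x) \<partial>lborel)"
    have ii: "integrable lborel (\<lambda>x. (v x)\<^sup>2 * indicator {s. \<eta> \<le> \<bar>s\<bar>} (v x))"
      by (rule Bochner_Integration.integrable_bound[OF Lp(2)]) (auto simp: indicator_def)
    have "\<delta> \<le> I"
    proof (rule ccontr)
      assume "\<not> \<delta> \<le> I"
      then have I: "I \<le> \<delta>" by simp
      have "(\<integral>x. Prim f (S * v x) \<partial>lborel)
        \<le> (\<integral>x. w / 3 * (v x)\<^sup>2 + 1 / (3 * M') * \<bar>v x\<bar> powr q + L * ((v x)\<^sup>2 * indicator {s. \<eta> \<le> \<bar>s\<bar>} (v x)) \<partial>lborel)"
        by (intro integral_mono integrable_Prim[OF Lp] split Bochner_Integration.integrable_add integrable_mult_right Lp(2) vq ii)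
      also have "\<dots> = w / 3 * (\<integral>x. (v x)\<^sup>2 \<partial>lborel) + 1 / (3 * M') * (\<integral>x. \<bar>v x\<bar> powr q \<partial>lborel) + L * I"
        using Lp(2) vq ii by (simp add: I_def)
      also have "\<dots> \<le> 1 / 3 + 1 / 3 + 1 / 3"
      proof (intro add_mono)
        show "w / 3 * (\<integral>x. (v x)\<^sup>2 \<partial>lborel) \<le> 1 / 3" using v2w by simp
        show "1 / (3 * M') * (\<integral>x. \<bar>v x\<bar> powr q \<partial>lborel) \<le> 1 / 3"
          using vqM by (simp add: field_simps M'_def)
        show "L * I \<le> 1 / 3" using mult_left_mono[OF I \<eta>(2)] \<delta>(2) by linarith
      qed
      finally have "(\<integral>x. Prim f (S * v x) \<partial>lborel) \<le> 1" by simp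
      moreover have "JW f W (\<lambda>x. S * v x) = (2 * (D + 2)) / 2 - (\<integral>x. Prim f (S * v x) \<partial>lborel)"
        unfolding JW_def Qform_scale[OF v(1) W(1)] v(2) S(2) by (simp only: mult_1_right)
      ultimately have "D + 1 \<le> JW f W (\<lambda>x. S * v x)" by (simp add: field_simps)
      also have "(\<lambda>x. S * v x) = (\<lambda>x. (S / m) * (m * v x))" using m(1) by auto
      also have "JW f W \<dots> \<le> JW f W (\<lambda>x. m * v x)"
        by (rule JW_scale_le[OF m(2) W(1)]) (use S m in auto)
      finally show False using m(3) by simp
    qed
    show "t \<le> r / \<eta>"
    proof (rule ccontr)
      assume "\<not> t \<le> r / \<eta>"
      then have "r \<le> t * \<eta>" using \<eta> by (simp add: field_simps)
      from fiber_ge[OF Lp r(2) \<eta>(1) t(1) this] have "3 / \<delta> * I \<le> 2" using t(2) by (simp add: I_def)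
      moreover have "3 / \<delta> * \<delta> \<le> 3 / \<delta> * I" using \<open>\<delta> \<le> I\<close> \<delta>(1) by (intro mult_left_mono) auto
      ultimately show False using \<delta>(1) by simp
    qed
  qed
qed

text \<open>\<open>u\<close> is replaced by the Nehari function for \<open>W'\<close> on its own
  ray. In passing to \<open>W'\<close> at that point the energy rises by at most \<epsilon>/2 times
  the squared L2 norm, and returning to \<open>u\<close> can only increase the energy for
  \<open>W\<close>. \<open>R\<close> depends only on \<open>D\<close> and \<open>w\<close>, so the
  two potentials can exchange roles.\<close>

lemma nehari_transfer:
  assumes D: "0 \<le> D" and w: "0 < w"
  obtains R where "0 \<le> R"
    "\<And>W W' (u :: (real^'k) \<times> (real^'m) \<Rightarrow> real) \<epsilon>.
       Linf_pot W \<Longrightarrow> (AE x in lborel. w \<le> W x) \<Longrightarrow> Linf_pot W' \<Longrightarrow> (AE x in lborel. w \<le> W' x) \<Longrightarrow>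
       (AE x in lborel. \<bar>W' x - W x\<bar> \<le> \<epsilon>) \<Longrightarrow> 0 \<le> \<epsilon> \<Longrightarrow> \<epsilon> \<le> w \<Longrightarrow> u \<in> nehari f W \<Longrightarrow> JW f W u \<le> D \<Longrightarrow>
       \<exists>u'\<in>nehari f W'. JW f W' u' \<le> JW f W u + \<epsilon> * R"
proof -
  obtain R where R: "0 \<le> R"
    "\<And>W (v :: (real^'k) \<times> (real^'m) \<Rightarrow> real) m t.
       Linf_pot W \<Longrightarrow> (AE x in lborel. w \<le> W x) \<Longrightarrow> v \<in> YG \<Longrightarrow> Qform W v = 1 \<Longrightarrow> 0 < m \<Longrightarrow>
       (\<lambda>x. m * v x) \<in> nehari f W \<Longrightarrow> JW f W (\<lambda>x. m * v x) \<le> D \<Longrightarrow> 0 \<le> t \<Longrightarrow> fiber v t \<le> 2 \<Longrightarrow> t \<le> R"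
    using fiber_parameter_bounded[OF D w] by blast
  \<comment> \<open>A parameter at most \<open>R\<close> and a normalised function of squared L2
    norm at most 1/w; the remaining 1/2 comes from the energy.\<close>
  show ?thesis
  proof (rule that[of "R\<^sup>2 / w / 2"])
    show "0 \<le> R\<^sup>2 / w / 2" using w by simp
    fix W W' and u :: "(real^'k) \<times> (real^'m) \<Rightarrow> real" and \<epsilon> :: real
    assume W: "Linf_pot W" "AE x in lborel. w \<le> W x" and W': "Linf_pot W'" "AE x in lborel. w \<le> W' x"
      and near: "AE x in lborel. \<bar>W' x - W x\<bar> \<le> \<epsilon>" and \<epsilon>: "0 \<le> \<epsilon>" "\<epsilon> \<le> w"
      and u: "u \<in> nehari f W" "JW f W u \<le> D"
    note Y = nehari_D(1)[OF u(1)] and nz = nehari_D(2)[OF u(1)]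
    define m where "m = sqrt (Qform W u)"
    have m: "0 < m" "m\<^sup>2 = Qform W u" using Qform_pos[OF Y W w nz] by (auto simp: m_def)
    define v where "v = (\<lambda>x. (1 / m) * u x)"
    have v: "v \<in> YG" unfolding v_def by (rule YG_scale[OF Y])
    have Qv: "Qform W v = 1"
      unfolding v_def Qform_scale[OF Y W(1)] m(2)[symmetric] using m(1) by (simp add: power_divide)
    have uv: "u = (\<lambda>x. m * v x)" using m(1) by (auto simp: v_def)
    have vnz: "\<not> (AE x in lborel. v x = 0)" using nz m(1) by (simp add: v_def)
    obtain t where t: "0 < t" "(\<lambda>x. t * v x) \<in> nehari f W'"
      using nehari_scale_exists[OF v W' w vnz] by blast
    have "0 \<le> (\<integral>x. (norm (grad v x))\<^sup>2 \<partial>lborel)" by (intro integral_nonneg_AE) simp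
    then have v2w: "w * (\<integral>x. (v x)\<^sup>2 \<partial>lborel) \<le> 1"
      using Qform_ge[OF v W] Qv by linarith
    have v0: "0 \<le> (\<integral>x. (v x)\<^sup>2 \<partial>lborel)" by (intro integral_nonneg_AE) simp
    have "fiber v t = Qform W' v"
      using scale_in_nehari_iff[OF v W'(1) vnz t(1)] t(2) by simp
    also have "\<dots> \<le> 1 + \<epsilon> * (\<integral>x. (v x)\<^sup>2 \<partial>lborel)"
      using Qform_diff_le[OF v W(1) W'(1) near] Qv by simp
    \<comment> \<open>This is where \<epsilon> \<le> w enters: the change of potential at most
      doubles the normalised quadratic form, which explains the bound 2 on the fiber map.\<close>
    also have "\<dots> \<le> 1 + w * (\<integral>x. (v x)\<^sup>2 \<partial>lborel)"
      using \<epsilon> v0 by (intro add_left_mono mult_right_mono) auto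
    also have "\<dots> \<le> 2" using v2w by simp
    finally have "t \<le> R"
      using R(2)[OF W v Qv m(1)] u t(1) uv by auto
    have 1: "JW f W' (\<lambda>x. t * v x) \<le> JW f W (\<lambda>x. t * v x) + \<epsilon> * (\<integral>x. (t * v x)\<^sup>2 \<partial>lborel) / 2"
      using Qform_diff_le[OF YG_scale[OF v, of t] W(1) W'(1) near] by (simp add: JW_def)
    have "JW f W (\<lambda>x. (t / m) * u x) \<le> JW f W u"
      by (rule JW_scale_le[OF u(1) W(1)]) (use t m in auto)
    then have 2: "JW f W (\<lambda>x. t * v x) \<le> JW f W u" by (simp add: v_def)
    have "(\<integral>x. (t * v x)\<^sup>2 \<partial>lborel) = t\<^sup>2 * (\<integral>x. (v x)\<^sup>2 \<partial>lborel)" by (simp add: power_mult_distrib)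
    also have "\<dots> \<le> R\<^sup>2 * (1 / w)"
      using \<open>t \<le> R\<close> t(1) v2w w v0 by (intro mult_mono power_mono) (auto simp: field_simps)
    finally have "\<epsilon> * (\<integral>x. (t * v x)\<^sup>2 \<partial>lborel) \<le> \<epsilon> * (R\<^sup>2 * (1 / w))" using \<epsilon>(1) by (rule mult_left_mono)
    then have "JW f W' (\<lambda>x. t * v x) \<le> JW f W u + \<epsilon> * (R\<^sup>2 / w / 2)" using 1 2 by simp
    then show "\<exists>u'\<in>nehari f W'. JW f W' u' \<le> JW f W u + \<epsilon> * (R\<^sup>2 / w / 2)"
      using t(2) by auto
  qed
qed

section \<open>Continuity of the ground state level\<close>

lemma cW_le:
  fixes W :: "(real^'k) \<times> (real^'m) \<Rightarrow> real"
  assumes "Linf_pot W" "u \<in> nehari f W"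
  shows "cW f W \<le> JW f W u"
  unfolding cW_def
  by (intro cInf_lower imageI assms bdd_belowI[of _ 0]) (use JW_nehari_nonneg assms in auto)

lemma cW_nonneg:
  fixes W :: "(real^'k) \<times> (real^'m) \<Rightarrow> real"
  assumes "Linf_pot W" "nehari f W \<noteq> {}"
  shows "0 \<le> cW f W"
  unfolding cW_def using assms JW_nehari_nonneg by (intro cInf_greatest) auto

lemma cW_approx:
  fixes W :: "(real^'k) \<times> (real^'m) \<Rightarrow> real"
  assumes "Linf_pot W" "nehari f W \<noteq> {}" "0 < e"
  obtains u where "u \<in> nehari f W" "JW f W u < cW f W + e"
proof -
  have "\<exists>x\<in>JW f W ` nehari f W. x < cW f W + e"
    unfolding cW_def
  proof (rule cInf_lessD[THEN bexE])
    show "Inf (JW f W ` nehari f W) < Inf (JW f W ` nehari f W) + e" using assms by simp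
  qed (use assms in auto)
  then show ?thesis using that by blast
qed

lemma cW_continuous:
  fixes V :: "(real^'k) \<times> (real^'m) \<Rightarrow> real" and Vn :: "nat \<Rightarrow> (real^'k) \<times> (real^'m) \<Rightarrow> real"
  assumes V: "Linf_pot V" "AE x in lborel. w \<le> V x" "0 < w"
    and Vn: "\<And>n. Linf_pot (Vn n)" "\<And>n. \<exists>w'>0. AE x in lborel. w' \<le> Vn n x"
    and conv: "\<And>\<epsilon>. \<epsilon> > 0 \<Longrightarrow> \<forall>\<^sub>F n in sequentially. AE x in lborel. \<bar>Vn n x - V x\<bar> \<le> \<epsilon>"
  shows "(\<lambda>n. cW f (Vn n)) \<longlonglongrightarrow> cW f V"
\<comment> \<open>Every nonzero function of \<open>YG\<close> can be scaled onto each of these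
  Nehari sets, so they are empty simultaneously. In that case all levels are the same default value
  of \<open>Inf {}\<close>.\<close>
proof (cases "nehari f V = {}")
  case True
  have "nehari f (Vn n) = {}" for n
  proof (rule ccontr)
    assume "nehari f (Vn n) \<noteq> {}"
    then obtain u where u: "u \<in> nehari f (Vn n)" by auto
    show False
      using nehari_scale_exists[OF nehari_D(1)[OF u] V nehari_D(2)[OF u]] True by auto
  qed
  then show ?thesis using True by (simp add: cW_def)
next
  case False
  have ne: "nehari f (Vn n) \<noteq> {}" for n
  proof -
    obtain u where u: "u \<in> nehari f V" using False by auto
    obtain w' where w': "0 < w'" "AE x in lborel. w' \<le> Vn n x" using Vn(2) by blast
    show ?thesis
      using nehari_scale_exists[OF nehari_D(1)[OF u] Vn(1) w'(2,1) nehari_D(2)[OF u]] by auto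
  qed
  \<comment> \<open>For e \<le> 1 the two almost minimal functions used below have energies under
    c(V) + 1/2 and c(V) + 3/2, so one energy bound covers both.\<close>
  define D where "D = cW f V + 2"
  have D: "0 \<le> D" using cW_nonneg[OF V(1) False] by (simp add: D_def)
  \<comment> \<open>Half of \<open>w\<close> remains a lower bound for V_n once V_n is within w/2 of
    V.\<close>
  obtain R where R: "0 \<le> R"
    "\<And>W W' (u :: (real^'k) \<times> (real^'m) \<Rightarrow> real) \<epsilon>.
       Linf_pot W \<Longrightarrow> (AE x in lborel. w / 2 \<le> W x) \<Longrightarrow> Linf_pot W' \<Longrightarrow> (AE x in lborel. w / 2 \<le> W' x) \<Longrightarrow>
       (AE x in lborel. \<bar>W' x - W x\<bar> \<le> \<epsilon>) \<Longrightarrow> 0 \<le> \<epsilon> \<Longrightarrow> \<epsilon> \<le> w / 2 \<Longrightarrow> u \<in> nehari f W \<Longrightarrow> JW f W u \<le> D \<Longrightarrow>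
       \<exists>u'\<in>nehari f W'. JW f W' u' \<le> JW f W u + \<epsilon> * R"
    using nehari_transfer[OF D half_gt_zero[OF V(3)]] by blast
  have V2: "AE x in lborel. w / 2 \<le> V x" using V(2) by eventually_elim (use V(3) in linarith)
  have "\<forall>\<^sub>F n in sequentially. \<bar>cW f (Vn n) - cW f V\<bar> < e" if e: "0 < e" "e \<le> 1" for e
  proof -
    define \<epsilon> where "\<epsilon> = min (w / 2) (e / (2 * (R + 1)))"
    have \<epsilon>: "0 < \<epsilon>" "\<epsilon> \<le> w / 2"
      using V(3) e R(1) by (simp add: \<epsilon>_def) (simp only: \<epsilon>_def min.cobounded1)
    have "\<epsilon> * R \<le> e / (2 * (R + 1)) * R" using R(1) by (intro mult_right_mono) (auto simp: \<epsilon>_def)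
    also have "\<dots> \<le> e / 2" using R(1) e by (simp add: field_simps)
    finally have \<epsilon>R: "\<epsilon> * R \<le> e / 2" .
    have "\<bar>cW f (Vn n) - cW f V\<bar> < e" if n: "AE x in lborel. \<bar>Vn n x - V x\<bar> \<le> \<epsilon>" for n
    proof -
      have Vn2: "AE x in lborel. w / 2 \<le> Vn n x"
        using V(2) n by eventually_elim (use \<epsilon> in linarith)
      have n': "AE x in lborel. \<bar>V x - Vn n x\<bar> \<le> \<epsilon>" using n by (simp add: abs_minus_commute)
      obtain u where u: "u \<in> nehari f V" "JW f V u < cW f V + e / 2"
        using cW_approx[OF V(1) False, of "e / 2"] e by auto
      then have "JW f V u \<le> D" using e by (simp add: D_def)
      from R(2)[OF V(1) V2 Vn(1) Vn2 n _ \<epsilon>(2) u(1) this] \<epsilon>(1)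
      obtain u' where u': "u' \<in> nehari f (Vn n)" "JW f (Vn n) u' \<le> JW f V u + \<epsilon> * R" by auto
      \<comment> \<open>This direction goes first: it bounds the level of V_n, and with it the
        energy of \<open>z\<close>, before the constant \<open>R\<close> may be used for
        V_n.\<close>
      have upper: "cW f (Vn n) < cW f V + e"
        using cW_le[OF Vn(1) u'(1)] u' u \<epsilon>R by linarith
      obtain z where z: "z \<in> nehari f (Vn n)" "JW f (Vn n) z < cW f (Vn n) + e / 2"
        using cW_approx[OF Vn(1) ne, of "e / 2"] e by auto
      then have "JW f (Vn n) z \<le> D" using upper e by (simp add: D_def)
      from R(2)[OF Vn(1) Vn2 V(1) V2 n' _ \<epsilon>(2) z(1) this] \<epsilon>(1)
      obtain z' where z': "z' \<in> nehari f V" "JW f V z' \<le> JW f (Vn n) z + \<epsilon> * R" by auto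
      have "cW f V < cW f (Vn n) + e"
        using cW_le[OF V(1) z'(1)] z' z \<epsilon>R by linarith
      with upper show ?thesis by linarith
    qed
    then show ?thesis using conv[OF \<epsilon>(1)] by (auto elim: eventually_mono)
  qed
  note small = this
  show ?thesis
  proof (rule tendstoI)
    fix e :: real assume "0 < e"
    then show "\<forall>\<^sub>F n in sequentially. dist (cW f (Vn n)) (cW f V) < e"
      using small[of "min e 1"] by (auto simp: dist_real_def elim: eventually_mono)
  qed
qed

end

end

lemma V1_lower_bound:
  assumes "Linf_pot W" "V1 W"
  shows "Inf (range W) \<le> W x" "0 < Inf (range W)"
proof -
  have "bdd_below (range W)" using assms(1) by (simp add: Linf_pot_def bounded_imp_bdd_below)
  then show "Inf (range W) \<le> W x" by (rule cInf_lower[rotated]) auto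
  show "0 < Inf (range W)" using assms(2) by (simp add: V1_def)
qed

theorem theorem3p3:
  fixes f :: "real \<Rightarrow> real"
    and V :: "(real^'k) \<times> (real^'m) \<Rightarrow> real"
    and Vn :: "nat \<Rightarrow> (real^'k) \<times> (real^'m) \<Rightarrow> real"
  assumes K2: "CARD('k) \<ge> 2"
    and F1: "continuous_on UNIV f"
      "\<exists>C p. 2 < p \<and> p < 2 * real (CARD('k) + CARD('m)) / (real (CARD('k) + CARD('m)) - 2)
               \<and> (\<forall>u. \<bar>f u\<bar> \<le> C * (1 + \<bar>u\<bar> powr (p - 1)))"
    and F2: "((\<lambda>u. f u / u) \<longlongrightarrow> 0) (at 0)"
    and F3: "filterlim (\<lambda>u. Prim f u / u\<^sup>2) at_top at_infinity"
    and F4: "strict_mono_on {..<0} (\<lambda>u. f u / \<bar>u\<bar>)" "strict_mono_on {0<..} (\<lambda>u. f u / \<bar>u\<bar>)"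
    and V: "Linf_pot V" "V1 V"
    and Vn: "\<And>n. Linf_pot (Vn n)" "\<And>n. V1 (Vn n)"
    and conv: "\<And>\<epsilon>. \<epsilon> > 0 \<Longrightarrow> \<forall>\<^sub>F n in sequentially. AE x in lborel. \<bar>Vn n x - V x\<bar> \<le> \<epsilon>"
  shows "(\<lambda>n. cW f (Vn n)) \<longlonglongrightarrow> cW f V"
proof -
  obtain C p where p: "2 < p" "p < 2 * real (CARD('k) + CARD('m)) / (real (CARD('k) + CARD('m)) - 2)"
    and growth: "\<And>u. \<bar>f u\<bar> \<le> C * (1 + \<bar>u\<bar> powr (p - 1))"
    using F1(2) by blast
  interpret superquadratic f C p
    using F1(1) p(1) growth F2 F3 F4 by unfold_locales auto
  have "0 < CARD('m)" by simp
  \<comment> \<open>Positivity of N - 2 permits clearing the denominator of the critical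
    exponent.\<close>
  then have "2 < real (CARD('k) + CARD('m))" using K2 by linarith
  then have sub: "(real DIM((real^'k) \<times> (real^'m)) - 2) * p < 2 * real DIM((real^'k) \<times> (real^'m))"
    using p(2) by (simp add: field_simps)
  show ?thesis
  proof (rule cW_continuous[OF sub V(1) _ V1_lower_bound(2)[OF V] Vn(1) _ conv])
    show "AE x in lborel. Inf (range V) \<le> V x" using V1_lower_bound(1)[OF V] by simp
    show "\<exists>w'>0. AE x in lborel. w' \<le> Vn n x" for n
      using V1_lower_bound[OF Vn(1,2), of n] by (intro exI[of _ "Inf (range (Vn n))"]) simp
  qed
qed

end
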